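(* Every right $a$-ring $R$ is stably-finite; that is, for every integer $n\ge 1$ the matrix ring $\mathbb{M}_n(R)$ is directly-finite.
   Context: Rings are associative with identity. A right module $M$ is automorphism-invariant if $\varphi(M)\subseteq M$ for every automorphism $\varphi$ of its injective envelope $E(M)$. A ring $R$ is a right $a$-ring if every right ideal of $R$ is automorphism-invariant as a right $R$-module. A ring $S$ is directly-finite if $xy=1$ implies $yx=1$ for all $x,y\in S$. *)

theory Defs
  imports Complex_Main "HOL-Algebra.Module" "HOL-Algebra.AbelCoset" "HOL-Library.FuncSet"
begin

section \<open>Right modules\<close>

text \<open>
  The library's locale \<^locale>\<open>module\<close> requires a commutative ring of scalars, so only its record
  type is reused here. The expression \<open>r \<odot>\<^bsub>M\<^esub> x\<close> stands for the right action \<open>x \<cdot> r\<close>; this is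
  visible in \<open>smult_assoc\<close>, which reads \<open>x \<cdot> (r s) = (x \<cdot> r) \<cdot> s\<close>. The multiplication and the unit
  which the record type inherits from rings carry no meaning.
\<close>

locale right_module = R?: ring R + M?: abelian_group M
  for R (structure) and M :: "('a, 'b, 'n) module_scheme" (structure) +
  assumes smult_closed [simp, intro]:
      "\<lbrakk>r \<in> carrier R; x \<in> carrier M\<rbrakk> \<Longrightarrow> r \<odot>\<^bsub>M\<^esub> x \<in> carrier M"
    and smult_l_distr:
      "\<lbrakk>r \<in> carrier R; s \<in> carrier R; x \<in> carrier M\<rbrakk>
        \<Longrightarrow> (r \<oplus>\<^bsub>R\<^esub> s) \<odot>\<^bsub>M\<^esub> x = (r \<odot>\<^bsub>M\<^esub> x) \<oplus>\<^bsub>M\<^esub> (s \<odot>\<^bsub>M\<^esub> x)"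
    and smult_r_distr:
      "\<lbrakk>r \<in> carrier R; x \<in> carrier M; y \<in> carrier M\<rbrakk>
        \<Longrightarrow> r \<odot>\<^bsub>M\<^esub> (x \<oplus>\<^bsub>M\<^esub> y) = (r \<odot>\<^bsub>M\<^esub> x) \<oplus>\<^bsub>M\<^esub> (r \<odot>\<^bsub>M\<^esub> y)"
    and smult_assoc:
      "\<lbrakk>r \<in> carrier R; s \<in> carrier R; x \<in> carrier M\<rbrakk>
        \<Longrightarrow> (r \<otimes>\<^bsub>R\<^esub> s) \<odot>\<^bsub>M\<^esub> x = s \<odot>\<^bsub>M\<^esub> (r \<odot>\<^bsub>M\<^esub> x)"
    and smult_one [simp]:
      "x \<in> carrier M \<Longrightarrow> \<one>\<^bsub>R\<^esub> \<odot>\<^bsub>M\<^esub> x = x"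

definition right_submodule ::
    "('a, 'm) ring_scheme \<Rightarrow> 'b set \<Rightarrow> ('a, 'b, 'n) module_scheme \<Rightarrow> bool" where
  "right_submodule R N M \<longleftrightarrow>
     additive_subgroup N M \<and> (\<forall>r\<in>carrier R. \<forall>x\<in>N. r \<odot>\<^bsub>M\<^esub> x \<in> N)"

definition right_module_hom ::
    "('a, 'm) ring_scheme \<Rightarrow> ('a, 'b, 'n) module_scheme \<Rightarrow> ('a, 'c, 'k) module_scheme \<Rightarrow> ('b \<Rightarrow> 'c) set"
  where
  "right_module_hom R M N =
     {f \<in> hom (add_monoid M) (add_monoid N).
        \<forall>r\<in>carrier R. \<forall>x\<in>carrier M. f (r \<odot>\<^bsub>M\<^esub> x) = r \<odot>\<^bsub>N\<^esub> f x}"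

definition right_module_auto ::
    "('a, 'm) ring_scheme \<Rightarrow> ('a, 'b, 'n) module_scheme \<Rightarrow> ('b \<Rightarrow> 'b) set" where
  "right_module_auto R M = {f \<in> right_module_hom R M M. bij_betw f (carrier M) (carrier M)}"


section \<open>Injective envelopes and automorphism-invariant modules\<close>

text \<open>
  A quantifier inside a definition cannot range over types, so the modules \<open>A\<close> and \<open>B\<close> against which
  injectivity is tested must have their elements in one fixed type. The type \<^typ>\<open>'a + 'b\<close> contains
  a copy of the regular module of \<open>R\<close> and of all its right ideals; hence, by Baer's criterion, a
  module satisfying the definition has the extension property for modules over every type.
\<close>

definition injective_right_module ::
    "('a, 'm) ring_scheme \<Rightarrow> ('a, 'b, 'n) module_scheme \<Rightarrow> bool" where
  "injective_right_module R E \<longleftrightarrow>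
     right_module R E \<and>
     (\<forall>(A :: ('a, 'a + 'b) module) (B :: ('a, 'a + 'b) module).
        \<forall>f \<in> right_module_hom R A B. \<forall>g \<in> right_module_hom R A E.
          right_module R A \<and> right_module R B \<and> inj_on f (carrier A) \<longrightarrow>
          (\<exists>h \<in> right_module_hom R B E. \<forall>x\<in>carrier A. h (f x) = g x))"

definition essential_submodule ::
    "('a, 'm) ring_scheme \<Rightarrow> 'b set \<Rightarrow> ('a, 'b, 'n) module_scheme \<Rightarrow> bool" where
  "essential_submodule R N M \<longleftrightarrow>
     right_submodule R N M \<and>
     (\<forall>L. right_submodule R L M \<and> N \<inter> L = {\<zero>\<^bsub>M\<^esub>} \<longrightarrow> L = {\<zero>\<^bsub>M\<^esub>})"

definition injective_envelope ::
    "('a, 'm) ring_scheme \<Rightarrow> ('a, 'b, 'n) module_scheme \<Rightarrow> ('a, 'e, 'k) module_scheme \<Rightarrow> ('b \<Rightarrow> 'e) \<Rightarrow> bool"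
  where
  "injective_envelope R M E \<iota> \<longleftrightarrow>
     injective_right_module R E \<and>
     \<iota> \<in> right_module_hom R M E \<and> inj_on \<iota> (carrier M) \<and>
     essential_submodule R (\<iota> ` carrier M) E"

text \<open>
  The type argument \<open>'e\<close> is the type of the elements of the injective envelope. Envelopes of \<open>M\<close> are
  isomorphic over \<open>M\<close>, so it does not matter which one is taken, and once \<open>'e\<close> is large enough to
  contain one the definition does not depend on \<open>'e\<close>; if \<open>'e\<close> is too small, it is false. For a right
  ideal of a ring over \<open>'a\<close>, the type \<^typ>\<open>'a \<Rightarrow> ('a \<Rightarrow> rat) set\<close> is always large enough: it contains
  \<open>Hom\<^sub>\<int>(R, D)\<close>, where \<open>D\<close> is a divisible group containing \<open>R\<close>, namely a quotient of the group
  of finitely supported functions \<^typ>\<open>'a \<Rightarrow> rat\<close>.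
\<close>

definition automorphism_invariant ::
    "'e itself \<Rightarrow> ('a, 'm) ring_scheme \<Rightarrow> ('a, 'b, 'n) module_scheme \<Rightarrow> bool" where
  "automorphism_invariant (_ :: 'e itself) R M \<longleftrightarrow>
     right_module R M \<and>
     (\<exists>(E :: ('a, 'e) module) \<iota>.
        injective_envelope R M E \<iota> \<and>
        (\<forall>\<phi> \<in> right_module_auto R E. \<phi> ` (\<iota> ` carrier M) \<subseteq> \<iota> ` carrier M))"


section \<open>Right a-rings\<close>

definition right_ideal :: "'a set \<Rightarrow> ('a, 'm) ring_scheme \<Rightarrow> bool" where
  "right_ideal I R \<longleftrightarrow>
     additive_subgroup I R \<and> (\<forall>x\<in>I. \<forall>r\<in>carrier R. x \<otimes>\<^bsub>R\<^esub> r \<in> I)"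

definition right_ideal_module :: "('a, 'm) ring_scheme \<Rightarrow> 'a set \<Rightarrow> ('a, 'a) module" where
  "right_ideal_module R I =
     \<lparr>carrier = I, mult = mult R, one = \<one>\<^bsub>R\<^esub>, zero = \<zero>\<^bsub>R\<^esub>, add = add R, smult = (\<lambda>r x. x \<otimes>\<^bsub>R\<^esub> r)\<rparr>"

definition right_a_ring :: "'e itself \<Rightarrow> ('a, 'm) ring_scheme \<Rightarrow> bool" where
  "right_a_ring (t :: 'e itself) R \<longleftrightarrow>
     ring R \<and>
     (\<forall>I. right_ideal I R \<longrightarrow> automorphism_invariant t R (right_ideal_module R I))"

lemma right_module_right_ideal_module:
  assumes "ring R" and "right_ideal I R"
  shows "right_module R (right_ideal_module R I)"
proof -
  interpret ring R by fact
  have I: "additive_subgroup I R" and sm: "\<And>x r. x \<in> I \<Longrightarrow> r \<in> carrier R \<Longrightarrow> x \<otimes>\<^bsub>R\<^esub> r \<in> I"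
    using assms(2) by (auto simp: right_ideal_def)
  interpret I: additive_subgroup I R by (rule I)
  have sub: "x \<in> carrier R" if "x \<in> I" for x
    using that I.a_subset by blast
  have "abelian_group (right_ideal_module R I)"
  proof (rule abelian_groupI)
    fix x assume "x \<in> carrier (right_ideal_module R I)"
    then have "x \<in> I" by (simp add: right_ideal_module_def)
    then show "\<exists>y\<in>carrier (right_ideal_module R I).
        y \<oplus>\<^bsub>right_ideal_module R I\<^esub> x = \<zero>\<^bsub>right_ideal_module R I\<^esub>"
      by (auto simp: right_ideal_module_def sub l_neg intro!: bexI[of _ "\<ominus>\<^bsub>R\<^esub> x"])
  qed (auto simp: right_ideal_module_def sub a_ac)
  then show ?thesis
    unfolding right_module_def right_module_axioms_def
    using assms(1) by (auto simp: right_ideal_module_def sub sm l_distr r_distr m_assoc)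
qed


section \<open>Matrix rings and stable finiteness\<close>

text \<open>
  The matrices of the libraries take their entries from a type, not from the carrier set of a ring.
  A matrix is therefore a function on \<open>{..<n} \<times> {..<n}\<close>, extended by
  \<^term>\<open>undefined\<close>.
\<close>

definition matrix_ring :: "('a, 'm) ring_scheme \<Rightarrow> nat \<Rightarrow> (nat \<times> nat \<Rightarrow> 'a) ring" where
  "matrix_ring R n =
     \<lparr>carrier = {..<n} \<times> {..<n} \<rightarrow>\<^sub>E carrier R,
      mult = (\<lambda>A B. \<lambda>(i, j)\<in>{..<n} \<times> {..<n}. \<Oplus>\<^bsub>R\<^esub>k\<in>{..<n}. A (i, k) \<otimes>\<^bsub>R\<^esub> B (k, j)),
      one = (\<lambda>(i, j)\<in>{..<n} \<times> {..<n}. if i = j then \<one>\<^bsub>R\<^esub> else \<zero>\<^bsub>R\<^esub>),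
      zero = (\<lambda>(i, j)\<in>{..<n} \<times> {..<n}. \<zero>\<^bsub>R\<^esub>),
      add = (\<lambda>A B. \<lambda>(i, j)\<in>{..<n} \<times> {..<n}. A (i, j) \<oplus>\<^bsub>R\<^esub> B (i, j))\<rparr>"

definition directly_finite :: "('a, 'm) ring_scheme \<Rightarrow> bool" where
  "directly_finite S \<longleftrightarrow>
     (\<forall>x\<in>carrier S. \<forall>y\<in>carrier S. x \<otimes>\<^bsub>S\<^esub> y = \<one>\<^bsub>S\<^esub> \<longrightarrow> y \<otimes>\<^bsub>S\<^esub> x = \<one>\<^bsub>S\<^esub>)"

definition stably_finite :: "('a, 'm) ring_scheme \<Rightarrow> bool" where
  "stably_finite R \<longleftrightarrow> (\<forall>n\<ge>1. directly_finite (matrix_ring R n))"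

end

theory Submission
  imports Defs "HOL-Library.Nat_Bijection"
begin

text \<open>
  Let \<open>R\<close> be a right a-ring and suppose that \<open>X Y = 1\<close> but \<open>Y X \<noteq> 1\<close> for \<open>n \<times> n\<close> matrices over
  \<open>R\<close>. A nonzero column \<open>z\<close> of \<open>1 - Y X\<close> satisfies \<open>X z = 0\<close>, so the vectors \<open>Y\<^sup>j z\<close> generate
  infinitely many independent copies of the cyclic module \<open>z R \<cong> R / A\<close> inside \<open>R\<^sup>n\<close>, where \<open>A\<close> is the
  annihilator of \<open>z\<close>. The proof shows that \<open>R\<^sup>n\<close> has no room for them.

  The injective envelope enters only through two statements about right ideals
  (\<open>automorphism_invariant_right_ideal\<close> and \<open>automorphism_invariant_left_mult\<close>). If \<open>M\<close> is essential in
  a right ideal \<open>N\<close>, every automorphism \<open>\<sigma>\<close> of \<open>N\<close> maps \<open>M\<close> into itself: the envelope of \<open>M\<close> is one of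
  \<open>N\<close> as well, and \<open>\<sigma>\<close> extends to an automorphism of it. If \<open>N\<close> is essential in \<open>R\<close>, then \<open>\<sigma>\<close> is
  moreover a left multiplication, because the extension maps \<open>1\<close> into \<open>R\<close>.

  These two facts are applied to shears of a sum \<open>V \<oplus> V'\<close> of two right ideals that are isomorphic
  by a map \<open>f\<close>. First, \<open>V\<close> has no proper essential right subideal \<open>W\<close>, since the shear along the
  inverse of \<open>f\<close> would move \<open>W \<oplus> V'\<close>. Second, \<open>f\<close> and its inverse are left multiplications by some
  \<open>a\<close> and \<open>b\<close> for which \<open>V'\<close> is essential in \<open>a R\<close>. Together they give \<open>V' = a R\<close>, and so \<open>b a\<close> is
  an element of \<open>V\<close> that acts on \<open>V\<close> as the identity (\<open>twin_generator\<close>): \<open>V\<close> is a direct summand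
  of \<open>R\<close>.

  Hence \<open>R\<close> cannot contain infinitely many independent copies of \<open>R / A \<noteq> 0\<close>, because the sum of
  every second copy would be finitely generated (\<open>no_infinite_free_row\<close>). Also, if \<open>R\<close> contains even
  two independent copies of \<open>R / A\<close>, then \<open>R / A\<close> has a simple submodule
  (\<open>free_pair_maximal_quotient\<close>).

  It remains to pass from \<open>R\<close> to \<open>R\<^sup>n\<close>, which is done by eliminating one coordinate at a time
  (\<open>free_modulo_elimination\<close>). If \<open>R / A\<close> has a simple submodule, one may assume that \<open>R / A\<close> is
  itself simple; then finitely many of the given copies span, in a fixed coordinate, all the others,
  and Gaussian elimination leaves infinitely many copies with one coordinate fewer. If \<open>R / A\<close> has
  no simple submodule, then no nonzero submodule of \<open>R / A\<close> occurs twice in \<open>R\<close>; so, after shrinking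
  the copies to nonzero submodules, elimination in one coordinate costs at most one copy, and \<open>R\<^sup>n\<close>
  contains at most \<open>n\<close> independent copies.
\<close>

section \<open>Homomorphisms of right modules\<close>

lemma right_module_homI:
  assumes "\<And>x. x \<in> carrier M \<Longrightarrow> f x \<in> carrier N"
    and "\<And>x y. x \<in> carrier M \<Longrightarrow> y \<in> carrier M \<Longrightarrow> f (x \<oplus>\<^bsub>M\<^esub> y) = f x \<oplus>\<^bsub>N\<^esub> f y"
    and "\<And>r x. r \<in> carrier R \<Longrightarrow> x \<in> carrier M \<Longrightarrow> f (r \<odot>\<^bsub>M\<^esub> x) = r \<odot>\<^bsub>N\<^esub> f x"
  shows "f \<in> right_module_hom R M N"
  using assms by (auto simp: right_module_hom_def hom_def)

lemma right_module_homD: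
  assumes "f \<in> right_module_hom R M N"
  shows "x \<in> carrier M \<Longrightarrow> f x \<in> carrier N"
    and "x \<in> carrier M \<Longrightarrow> y \<in> carrier M \<Longrightarrow> f (x \<oplus>\<^bsub>M\<^esub> y) = f x \<oplus>\<^bsub>N\<^esub> f y"
    and "r \<in> carrier R \<Longrightarrow> x \<in> carrier M \<Longrightarrow> f (r \<odot>\<^bsub>M\<^esub> x) = r \<odot>\<^bsub>N\<^esub> f x"
  using assms by (auto simp: right_module_hom_def hom_def)

lemma right_module_hom_zero:
  assumes "f \<in> right_module_hom R M N" "right_module R M" "right_module R N"
  shows "f \<zero>\<^bsub>M\<^esub> = \<zero>\<^bsub>N\<^esub>"
proof -
  interpret M: right_module R M by fact
  interpret N: right_module R N by fact
  have "f \<in> hom (add_monoid M) (add_monoid N)"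
    using assms(1) by (simp add: right_module_hom_def)
  from hom_one[OF this M.a_group N.a_group] show ?thesis by simp
qed

lemma right_module_hom_inj_onI:
  assumes f: "f \<in> right_module_hom R M N" and M: "right_module R M" and N: "right_module R N"
    and ker: "\<And>x. x \<in> carrier M \<Longrightarrow> f x = \<zero>\<^bsub>N\<^esub> \<Longrightarrow> x = \<zero>\<^bsub>M\<^esub>"
  shows "inj_on f (carrier M)"
proof (rule inj_onI)
  interpret M: right_module R M by fact
  interpret N: right_module R N by fact
  fix x y assume x: "x \<in> carrier M" and y: "y \<in> carrier M" and eq: "f x = f y"
  have "f (x \<ominus>\<^bsub>M\<^esub> y) \<oplus>\<^bsub>N\<^esub> f y = f x"
    using x y by (simp add: right_module_homD(2)[OF f, symmetric] M.minus_eq M.a_assoc M.l_neg)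
  then have "f (x \<ominus>\<^bsub>M\<^esub> y) = \<zero>\<^bsub>N\<^esub>"
    using x y eq by (simp add: right_module_homD(1)[OF f])
  then have "x \<ominus>\<^bsub>M\<^esub> y = \<zero>\<^bsub>M\<^esub>" using ker x y by simp
  moreover have "(x \<ominus>\<^bsub>M\<^esub> y) \<oplus>\<^bsub>M\<^esub> y = x"
    using x y by (simp add: M.minus_eq M.a_assoc M.l_neg)
  ultimately show "x = y" using y by simp
qed

lemma right_module_hom_compose:
  assumes "f \<in> right_module_hom R M N" "g \<in> right_module_hom R N P"
  shows "(\<lambda>x. g (f x)) \<in> right_module_hom R M P"
  using assms by (auto intro!: right_module_homI simp: right_module_homD)

lemma right_submodule_cyclic:
  assumes "right_module R M" and x: "x \<in> carrier M"
  shows "right_submodule R ((\<lambda>r. r \<odot>\<^bsub>M\<^esub> x) ` carrier R) M"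
proof -
  interpret M: right_module R M by fact
  have neg: "\<ominus>\<^bsub>M\<^esub> (r \<odot>\<^bsub>M\<^esub> x) = (\<ominus>\<^bsub>R\<^esub> r) \<odot>\<^bsub>M\<^esub> x" if "r \<in> carrier R" for r
  proof -
    have z: "\<zero>\<^bsub>R\<^esub> \<odot>\<^bsub>M\<^esub> x = \<zero>\<^bsub>M\<^esub>"
      using M.smult_l_distr[of "\<zero>\<^bsub>R\<^esub>" "\<zero>\<^bsub>R\<^esub>" x] x by simp
    have "((\<ominus>\<^bsub>R\<^esub> r) \<odot>\<^bsub>M\<^esub> x) \<oplus>\<^bsub>M\<^esub> (r \<odot>\<^bsub>M\<^esub> x) = \<zero>\<^bsub>M\<^esub>"
      using that x z by (simp add: M.smult_l_distr[symmetric] M.R.l_neg)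
    then show ?thesis using that x by (intro M.M.minus_equality) auto
  qed
  have "subgroup ((\<lambda>r. r \<odot>\<^bsub>M\<^esub> x) ` carrier R) (add_monoid M)"
  proof (rule group.subgroupI[OF M.a_group])
    fix a assume "a \<in> (\<lambda>r. r \<odot>\<^bsub>M\<^esub> x) ` carrier R"
    then obtain r where r: "r \<in> carrier R" "a = r \<odot>\<^bsub>M\<^esub> x" by blast
    show "inv\<^bsub>add_monoid M\<^esub> a \<in> (\<lambda>r. r \<odot>\<^bsub>M\<^esub> x) ` carrier R"
      using neg[OF r(1)] r by (auto simp: a_inv_def[symmetric])
  next
    fix a b assume "a \<in> (\<lambda>r. r \<odot>\<^bsub>M\<^esub> x) ` carrier R" "b \<in> (\<lambda>r. r \<odot>\<^bsub>M\<^esub> x) ` carrier R"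
    then obtain r s where "r \<in> carrier R" "s \<in> carrier R" "a = r \<odot>\<^bsub>M\<^esub> x" "b = s \<odot>\<^bsub>M\<^esub> x" by blast
    then show "a \<otimes>\<^bsub>add_monoid M\<^esub> b \<in> (\<lambda>r. r \<odot>\<^bsub>M\<^esub> x) ` carrier R"
      using x by (auto simp: M.smult_l_distr[symmetric])
  qed (use x in auto)
  then show ?thesis
    unfolding right_submodule_def additive_subgroup_def
    using x by (auto simp: M.smult_assoc[symmetric])
qed

text \<open>
  Only the cyclic submodule generated by \<open>x\<close> has to be tested against \<open>N\<close>. All later arguments
  use essentiality in this elementwise form.
\<close>

lemma essential_submodule_meets:
  assumes M: "right_module R M" and N: "essential_submodule R N M"
    and x: "x \<in> carrier M" "x \<noteq> \<zero>\<^bsub>M\<^esub>"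
  obtains r where "r \<in> carrier R" "r \<odot>\<^bsub>M\<^esub> x \<in> N" "r \<odot>\<^bsub>M\<^esub> x \<noteq> \<zero>\<^bsub>M\<^esub>"
proof -
  interpret M: right_module R M by fact
  let ?L = "(\<lambda>r. r \<odot>\<^bsub>M\<^esub> x) ` carrier R"
  have L: "right_submodule R ?L M" by (rule right_submodule_cyclic[OF M x(1)])
  have "x \<in> ?L" using x by (intro image_eqI[of _ _ "\<one>\<^bsub>R\<^esub>"]) auto
  then have "?L \<noteq> {\<zero>\<^bsub>M\<^esub>}" using x by blast
  then have "N \<inter> ?L \<noteq> {\<zero>\<^bsub>M\<^esub>}" using N L by (auto simp: essential_submodule_def)
  moreover have "\<zero>\<^bsub>M\<^esub> \<in> N \<inter> ?L"
    using N L by (auto simp: essential_submodule_def right_submodule_def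
        dest!: additive_subgroup.zero_closed)
  ultimately show thesis using that by blast
qed

section \<open>Extending homomorphisms into injective modules\<close>

text \<open>
  Transport of structure along an injection \<open>t\<close>, which moves a module into the element type over which
  injectivity is tested.
\<close>

definition relabel :: "('b \<Rightarrow> 'c) \<Rightarrow> ('a, 'b, 'n) module_scheme \<Rightarrow> ('a, 'c) module" where
  "relabel t M = \<lparr>carrier = t ` carrier M, mult = (\<lambda>_ _. undefined), one = undefined,
     zero = t \<zero>\<^bsub>M\<^esub>, add = (\<lambda>x y. t (inv_into UNIV t x \<oplus>\<^bsub>M\<^esub> inv_into UNIV t y)),
     smult = (\<lambda>r x. t (r \<odot>\<^bsub>M\<^esub> inv_into UNIV t x))\<rparr>"

lemma right_module_relabel:
  assumes "right_module R M" and t: "inj t"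
  shows "right_module R (relabel t M)"
proof -
  interpret M: right_module R M by fact
  have "abelian_group (relabel t M)"
  proof (rule abelian_groupI)
    fix x assume "x \<in> carrier (relabel t M)"
    then obtain y where "y \<in> carrier M" "x = t y" by (auto simp: relabel_def)
    then show "\<exists>y\<in>carrier (relabel t M). y \<oplus>\<^bsub>relabel t M\<^esub> x = \<zero>\<^bsub>relabel t M\<^esub>"
      using t by (auto simp: relabel_def M.M.l_neg intro!: bexI[of _ "\<ominus>\<^bsub>M\<^esub> y"])
  qed (use t in \<open>auto simp: relabel_def M.M.a_ac\<close>)
  then show ?thesis
    unfolding right_module_def right_module_axioms_def
    using t M.R.ring_axioms
    by (auto simp: relabel_def M.smult_l_distr M.smult_r_distr M.smult_assoc)
qed

text \<open>
  The definition of injectivity tests modules with elements in the type \<^typ>\<open>'a + 'e\<close> only;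
  relabelling along the injections \<open>s\<close> and \<open>t\<close> transfers it to modules over other types. It is used
  with \<^const>\<open>Inl\<close> for right ideals and with \<^const>\<open>Inr\<close> for \<open>E\<close> itself.
\<close>

lemma injective_extend:
  fixes s :: "'b \<Rightarrow> 'a + 'e" and t :: "'c \<Rightarrow> 'a + 'e"
    and A :: "('a, 'b, 'm) module_scheme" and B :: "('a, 'c, 'n) module_scheme"
    and E :: "('a, 'e, 'k) module_scheme"
  assumes E: "injective_right_module R E" and A: "right_module R A" and B: "right_module R B"
    and s: "inj s" and t: "inj t"
    and f: "f \<in> right_module_hom R A B" and inj: "inj_on f (carrier A)"
    and g: "g \<in> right_module_hom R A E"
  obtains h where "h \<in> right_module_hom R B E" "\<And>x. x \<in> carrier A \<Longrightarrow> h (f x) = g x"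
proof -
  let ?A = "relabel s A" and ?B = "relabel t B"
  have f': "(\<lambda>x. t (f (inv_into UNIV s x))) \<in> right_module_hom R ?A ?B"
    using s t f by (intro right_module_homI) (auto simp: relabel_def right_module_homD[OF f])
  have g': "(\<lambda>x. g (inv_into UNIV s x)) \<in> right_module_hom R ?A E"
    using s g by (intro right_module_homI) (auto simp: relabel_def right_module_homD[OF g])
  interpret A: right_module R A by fact
  have inj': "inj_on (\<lambda>x. t (f (inv_into UNIV s x))) (carrier ?A)"
    using s inj by (auto simp: relabel_def inj_on_def inj_eq[OF t])
  have "\<exists>h\<in>right_module_hom R ?B E. \<forall>x\<in>carrier ?A. h (t (f (inv_into UNIV s x))) = g (inv_into UNIV s x)"
    using E[unfolded injective_right_module_def, THEN conjunct2, rule_format, OF f' g']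
      inj' right_module_relabel[OF A s] right_module_relabel[OF B t] by blast
  then obtain h where h: "h \<in> right_module_hom R ?B E"
      and hx: "\<And>x. x \<in> carrier ?A \<Longrightarrow> h (t (f (inv_into UNIV s x))) = g (inv_into UNIV s x)"
    by blast
  have "(\<lambda>x. h (t x)) \<in> right_module_hom R B E"
  proof (rule right_module_homI)
    fix x y assume xy: "x \<in> carrier B" "y \<in> carrier B"
    show "h (t x) \<in> carrier E" using right_module_homD(1)[OF h] xy by (auto simp: relabel_def)
    have "t x \<oplus>\<^bsub>?B\<^esub> t y = t (x \<oplus>\<^bsub>B\<^esub> y)" using t by (simp add: relabel_def)
    then show "h (t (x \<oplus>\<^bsub>B\<^esub> y)) = h (t x) \<oplus>\<^bsub>E\<^esub> h (t y)"
      using right_module_homD(2)[OF h, of "t x" "t y"] xy by (simp add: relabel_def)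
  next
    fix r x assume rx: "r \<in> carrier R" "x \<in> carrier B"
    have "r \<odot>\<^bsub>?B\<^esub> t x = t (r \<odot>\<^bsub>B\<^esub> x)" using t by (simp add: relabel_def)
    then show "h (t (r \<odot>\<^bsub>B\<^esub> x)) = r \<odot>\<^bsub>E\<^esub> h (t x)"
      using right_module_homD(3)[OF h, of r "t x"] rx by (simp add: relabel_def)
  qed
  moreover have "h (t (f x)) = g x" if "x \<in> carrier A" for x
    using hx[of "s x"] that s by (auto simp: relabel_def)
  ultimately show thesis using that by blast
qed

text \<open>
  Extend \<open>j \<circ> \<sigma>\<close> along \<open>j\<close> to \<open>\<phi>\<close>. An endomorphism of \<open>E\<close> is injective as soon as it is injective
  on the essential image of \<open>j\<close>, which applies to \<open>\<phi>\<close>. By injectivity of \<open>E\<close>, \<open>\<phi>\<close> then has a left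
  inverse \<open>q\<close>; the same criterion makes \<open>q\<close> injective, and this forces \<open>q\<close> to be a right inverse.
\<close>

lemma injective_extend_automorphism:
  fixes E :: "('a, 'e, 'k) module_scheme" and N :: "('a, 'a, 'n) module_scheme"
  assumes E: "injective_right_module R E" and N: "right_module R N"
    and j: "j \<in> right_module_hom R N E" "inj_on j (carrier N)"
    and ess: "\<And>x. x \<in> carrier E \<Longrightarrow> x \<noteq> \<zero>\<^bsub>E\<^esub> \<Longrightarrow>
       \<exists>r\<in>carrier R. \<exists>n\<in>carrier N. n \<noteq> \<zero>\<^bsub>N\<^esub> \<and> r \<odot>\<^bsub>E\<^esub> x = j n"
    and \<sigma>: "\<sigma> \<in> right_module_auto R N"
  shows "\<exists>\<phi>\<in>right_module_auto R E. \<forall>n\<in>carrier N. \<phi> (j n) = j (\<sigma> n)"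
proof -
  have EM: "right_module R E" using E by (simp add: injective_right_module_def)
  interpret E: right_module R E by fact
  interpret N: right_module R N by fact
  have \<sigma>h: "\<sigma> \<in> right_module_hom R N N" and \<sigma>b: "bij_betw \<sigma> (carrier N) (carrier N)"
    using \<sigma> by (auto simp: right_module_auto_def)
  have j0: "j \<zero>\<^bsub>N\<^esub> = \<zero>\<^bsub>E\<^esub>" by (rule right_module_hom_zero[OF j(1) N EM])
  have \<sigma>0: "\<sigma> \<zero>\<^bsub>N\<^esub> = \<zero>\<^bsub>N\<^esub>" by (rule right_module_hom_zero[OF \<sigma>h N N])
  have smult0: "r \<odot>\<^bsub>E\<^esub> \<zero>\<^bsub>E\<^esub> = \<zero>\<^bsub>E\<^esub>" if "r \<in> carrier R" for r
    using E.smult_r_distr[of r "\<zero>\<^bsub>E\<^esub>" "\<zero>\<^bsub>E\<^esub>"] that by simp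
  have inj_ess: "inj_on f (carrier E)"
    if f: "f \<in> right_module_hom R E E"
      and ker: "\<And>n. n \<in> carrier N \<Longrightarrow> f (j n) = \<zero>\<^bsub>E\<^esub> \<Longrightarrow> n = \<zero>\<^bsub>N\<^esub>" for f
  proof (rule right_module_hom_inj_onI[OF f EM EM])
    fix x assume x: "x \<in> carrier E" "f x = \<zero>\<^bsub>E\<^esub>"
    show "x = \<zero>\<^bsub>E\<^esub>"
    proof (rule ccontr)
      assume "x \<noteq> \<zero>\<^bsub>E\<^esub>"
      then obtain r n where rn: "r \<in> carrier R" "n \<in> carrier N" "n \<noteq> \<zero>\<^bsub>N\<^esub>" "r \<odot>\<^bsub>E\<^esub> x = j n"
        using ess x by blast
      have "f (j n) = r \<odot>\<^bsub>E\<^esub> f x" using rn x right_module_homD(3)[OF f] by metis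
      then show False using ker rn x smult0 by simp
    qed
  qed
  obtain \<phi> where \<phi>: "\<phi> \<in> right_module_hom R E E" and \<phi>j: "\<And>n. n \<in> carrier N \<Longrightarrow> \<phi> (j n) = j (\<sigma> n)"
    by (rule injective_extend[OF E N EM inj_Inl inj_Inr j right_module_hom_compose[OF \<sigma>h j(1)]]) blast
  have \<phi>i: "inj_on \<phi> (carrier E)"
  proof (rule inj_ess[OF \<phi>])
    fix n assume n: "n \<in> carrier N" "\<phi> (j n) = \<zero>\<^bsub>E\<^esub>"
    then have "j (\<sigma> n) = j \<zero>\<^bsub>N\<^esub>" using \<phi>j j0 by simp
    then have "\<sigma> n = \<sigma> \<zero>\<^bsub>N\<^esub>"
      using inj_onD[OF j(2)] n right_module_homD(1)[OF \<sigma>h] \<sigma>0 by simp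
    then show "n = \<zero>\<^bsub>N\<^esub>" using \<sigma>b n by (auto simp: bij_betw_def dest: inj_onD)
  qed
  have id: "(\<lambda>x. x) \<in> right_module_hom R E E" by (rule right_module_homI) auto
  obtain q where q: "q \<in> right_module_hom R E E" and q\<phi>: "\<And>x. x \<in> carrier E \<Longrightarrow> q (\<phi> x) = x"
    by (rule injective_extend[OF E EM EM inj_Inr inj_Inr \<phi> \<phi>i id]) blast
  have qi: "inj_on q (carrier E)"
  proof (rule inj_ess[OF q])
    fix n assume n: "n \<in> carrier N" "q (j n) = \<zero>\<^bsub>E\<^esub>"
    obtain m where m: "m \<in> carrier N" "n = \<sigma> m" using \<sigma>b n by (auto simp: bij_betw_def)
    then have "j m = \<zero>\<^bsub>E\<^esub>" using n q\<phi> \<phi>j[of m] right_module_homD(1)[OF j(1)] by metis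
    then have "m = \<zero>\<^bsub>N\<^esub>" using inj_onD[OF j(2)] j0 m by simp
    then show "n = \<zero>\<^bsub>N\<^esub>" using m \<sigma>0 by simp
  qed
  have "\<phi> (q x) = x" if "x \<in> carrier E" for x
    using inj_onD[OF qi] q\<phi> that right_module_homD(1)[OF q] right_module_homD(1)[OF \<phi>] by simp
  then have "carrier E \<subseteq> \<phi> ` carrier E"
    using right_module_homD(1)[OF q] by (metis image_eqI subsetI)
  then have "bij_betw \<phi> (carrier E) (carrier E)"
    using \<phi>i right_module_homD(1)[OF \<phi>] by (auto simp: bij_betw_def)
  then show ?thesis using \<phi> \<phi>j by (auto simp: right_module_auto_def)
qed

section \<open>Right ideals and their homomorphisms\<close>

abbreviation right_ideal_hom ::
    "('a, 'm) ring_scheme \<Rightarrow> 'a set \<Rightarrow> 'a set \<Rightarrow> ('a \<Rightarrow> 'a) set" where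
  "right_ideal_hom R V W \<equiv> right_module_hom R (right_ideal_module R V) (right_ideal_module R W)"

text \<open>
  Essential right subideals, by the cyclic test; for right ideals it is equivalent to
  \<^const>\<open>essential_submodule\<close>.
\<close>

definition essential_in ::
    "('a, 'm) ring_scheme \<Rightarrow> 'a set \<Rightarrow> 'a set \<Rightarrow> bool" where
  "essential_in R W V \<longleftrightarrow> right_ideal W R \<and> right_ideal V R \<and> W \<subseteq> V \<and>
     (\<forall>v\<in>V - {\<zero>\<^bsub>R\<^esub>}. \<exists>s\<in>carrier R. v \<otimes>\<^bsub>R\<^esub> s \<in> W - {\<zero>\<^bsub>R\<^esub>})"

lemma right_ideal_homI:
  assumes "\<And>x. x \<in> V \<Longrightarrow> f x \<in> W"
    and "\<And>x y. x \<in> V \<Longrightarrow> y \<in> V \<Longrightarrow> f (x \<oplus>\<^bsub>R\<^esub> y) = f x \<oplus>\<^bsub>R\<^esub> f y"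
    and "\<And>x r. x \<in> V \<Longrightarrow> r \<in> carrier R \<Longrightarrow> f (x \<otimes>\<^bsub>R\<^esub> r) = f x \<otimes>\<^bsub>R\<^esub> r"
  shows "f \<in> right_ideal_hom R V W"
  using assms by (intro right_module_homI) (auto simp: right_ideal_module_def)

lemma right_ideal_homD:
  assumes "f \<in> right_ideal_hom R V W"
  shows "x \<in> V \<Longrightarrow> f x \<in> W"
    and "x \<in> V \<Longrightarrow> y \<in> V \<Longrightarrow> f (x \<oplus>\<^bsub>R\<^esub> y) = f x \<oplus>\<^bsub>R\<^esub> f y"
    and "x \<in> V \<Longrightarrow> r \<in> carrier R \<Longrightarrow> f (x \<otimes>\<^bsub>R\<^esub> r) = f x \<otimes>\<^bsub>R\<^esub> r"
  using right_module_homD[OF assms] by (auto simp: right_ideal_module_def)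

context ring
begin

lemma right_idealI:
  assumes "I \<subseteq> carrier R" "\<zero> \<in> I" "\<And>x y. x \<in> I \<Longrightarrow> y \<in> I \<Longrightarrow> x \<oplus> y \<in> I"
    and mult: "\<And>x r. x \<in> I \<Longrightarrow> r \<in> carrier R \<Longrightarrow> x \<otimes> r \<in> I"
  shows "right_ideal I R"
proof -
  have "\<ominus> x \<in> I" if "x \<in> I" for x
    using mult[OF that, of "\<ominus> \<one>"] that assms(1) by (auto simp: r_minus subset_iff)
  then have "subgroup I (add_monoid R)"
    using assms by (intro add.subgroupI) (auto simp: a_inv_def)
  then show ?thesis using mult by (simp add: right_ideal_def additive_subgroup_def)
qed

lemma right_idealD:
  assumes "right_ideal I R"
  shows "I \<subseteq> carrier R" "\<zero> \<in> I" "x \<in> I \<Longrightarrow> x \<in> carrier R"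
    and "x \<in> I \<Longrightarrow> y \<in> I \<Longrightarrow> x \<oplus> y \<in> I"
    and "x \<in> I \<Longrightarrow> r \<in> carrier R \<Longrightarrow> x \<otimes> r \<in> I"
    and "x \<in> I \<Longrightarrow> \<ominus> x \<in> I"
    and "x \<in> I \<Longrightarrow> y \<in> I \<Longrightarrow> x \<ominus> y \<in> I"
proof -
  interpret additive_subgroup I R using assms by (simp add: right_ideal_def)
  show sub: "I \<subseteq> carrier R" and "\<zero> \<in> I" by (rule a_subset, rule zero_closed)
  show "x \<in> I \<Longrightarrow> x \<in> carrier R" using sub by blast
  show "x \<in> I \<Longrightarrow> y \<in> I \<Longrightarrow> x \<oplus> y \<in> I" by (rule a_closed)
  show "x \<in> I \<Longrightarrow> r \<in> carrier R \<Longrightarrow> x \<otimes> r \<in> I" using assms by (simp add: right_ideal_def)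
  have neg: "\<ominus> x \<in> I" if "x \<in> I" for x
  proof -
    have "x \<otimes> (\<ominus> \<one>) \<in> I" using assms that by (simp add: right_ideal_def)
    then show ?thesis using that sub by (simp add: r_minus subset_iff)
  qed
  show "x \<in> I \<Longrightarrow> \<ominus> x \<in> I" by (rule neg)
  show "x \<in> I \<Longrightarrow> y \<in> I \<Longrightarrow> x \<ominus> y \<in> I" using neg[of y] by (simp add: minus_eq a_closed)
qed

lemma add_minus_cancel: "x \<in> carrier R \<Longrightarrow> y \<in> carrier R \<Longrightarrow> (x \<ominus> y) \<oplus> y = x"
  by (simp add: minus_eq a_assoc l_neg)

lemma minus_eq_zeroD: "x \<ominus> y = \<zero> \<Longrightarrow> x \<in> carrier R \<Longrightarrow> y \<in> carrier R \<Longrightarrow> x = y"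
  by (metis add_minus_cancel l_zero)

lemma minus_self: "x \<in> carrier R \<Longrightarrow> x \<ominus> x = \<zero>"
  by (simp add: minus_eq r_neg)

lemma minus_distr_right:
  "x \<in> carrier R \<Longrightarrow> y \<in> carrier R \<Longrightarrow> z \<in> carrier R \<Longrightarrow> z \<otimes> (x \<ominus> y) = z \<otimes> x \<ominus> z \<otimes> y"
  by (simp add: minus_eq r_distr r_minus)

lemma minus_distr_left:
  "x \<in> carrier R \<Longrightarrow> y \<in> carrier R \<Longrightarrow> z \<in> carrier R \<Longrightarrow> (x \<ominus> y) \<otimes> z = x \<otimes> z \<ominus> y \<otimes> z"
  by (simp add: minus_eq l_distr l_minus)

lemma right_ideal_carrier: "right_ideal (carrier R) R"
  by (rule right_idealI) auto

lemma right_ideal_cyclic: "a \<in> carrier R \<Longrightarrow> right_ideal ((\<lambda>r. a \<otimes> r) ` carrier R) R"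
proof (rule right_idealI)
  fix x y assume "a \<in> carrier R" "x \<in> (\<lambda>r. a \<otimes> r) ` carrier R" "y \<in> (\<lambda>r. a \<otimes> r) ` carrier R"
  then show "x \<oplus> y \<in> (\<lambda>r. a \<otimes> r) ` carrier R" by (auto simp: r_distr[symmetric])
qed (auto simp: m_assoc intro: image_eqI[of _ _ "\<zero>"])

lemma right_ideal_left_mult:
  assumes a: "a \<in> carrier R" and I: "right_ideal I R"
  shows "right_ideal ((\<lambda>r. a \<otimes> r) ` I) R"
proof (rule right_idealI)
  note D = right_idealD[OF I]
  show "(\<lambda>r. a \<otimes> r) ` I \<subseteq> carrier R" using a D by auto
  show "\<zero> \<in> (\<lambda>r. a \<otimes> r) ` I" using a D by (intro image_eqI[of _ _ "\<zero>"]) auto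
next
  note D = right_idealD[OF I]
  fix x y assume "x \<in> (\<lambda>r. a \<otimes> r) ` I" "y \<in> (\<lambda>r. a \<otimes> r) ` I"
  then obtain r s where "r \<in> I" "s \<in> I" "x = a \<otimes> r" "y = a \<otimes> s" by blast
  then show "x \<oplus> y \<in> (\<lambda>r. a \<otimes> r) ` I"
    using a D by (intro image_eqI[of _ _ "r \<oplus> s"]) (auto simp: r_distr)
next
  note D = right_idealD[OF I]
  fix x s assume "x \<in> (\<lambda>r. a \<otimes> r) ` I" "s \<in> carrier R"
  then obtain r where "r \<in> I" "x = a \<otimes> r" by blast
  then show "x \<otimes> s \<in> (\<lambda>r. a \<otimes> r) ` I" using a D \<open>s \<in> carrier R\<close>
    by (intro image_eqI[of _ _ "r \<otimes> s"]) (auto simp: m_assoc)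
qed

lemma right_ideal_sum:
  assumes V: "right_ideal V R" and W: "right_ideal W R"
  shows "right_ideal (V <+>\<^bsub>R\<^esub> W) R" "V \<subseteq> V <+>\<^bsub>R\<^esub> W" "W \<subseteq> V <+>\<^bsub>R\<^esub> W"
proof -
  note v = right_idealD[OF V] and w = right_idealD[OF W]
  show "right_ideal (V <+>\<^bsub>R\<^esub> W) R"
  proof (rule right_idealI)
    show "V <+>\<^bsub>R\<^esub> W \<subseteq> carrier R" "\<zero> \<in> V <+>\<^bsub>R\<^esub> W"
      using v w by (auto simp: set_add_def' intro!: bexI[of _ "\<zero>"])
  next
    fix x y assume "x \<in> V <+>\<^bsub>R\<^esub> W" "y \<in> V <+>\<^bsub>R\<^esub> W"
    then obtain a b c d where
      "a \<in> V" "b \<in> W" "x = a \<oplus> b" "c \<in> V" "d \<in> W" "y = c \<oplus> d" by (auto simp: set_add_def')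
    moreover from this have "x \<oplus> y = (a \<oplus> c) \<oplus> (b \<oplus> d)" using v w by (simp add: a_ac)
    moreover have "a \<oplus> c \<in> V" "b \<oplus> d \<in> W" using calculation v w by auto
    ultimately show "x \<oplus> y \<in> V <+>\<^bsub>R\<^esub> W" unfolding set_add_def' by blast
  next
    fix x r assume "x \<in> V <+>\<^bsub>R\<^esub> W" and r: "r \<in> carrier R"
    then obtain a b where ab: "a \<in> V" "b \<in> W" "x = a \<oplus> b" by (auto simp: set_add_def')
    then have "x \<otimes> r = a \<otimes> r \<oplus> b \<otimes> r" using r v w by (simp add: l_distr)
    then show "x \<otimes> r \<in> V <+>\<^bsub>R\<^esub> W"
      using ab v(5)[OF _ r] w(5)[OF _ r] unfolding set_add_def' by blast
  qed
  show "V \<subseteq> V <+>\<^bsub>R\<^esub> W"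
  proof
    fix x assume x: "x \<in> V"
    then have "x = x \<oplus> \<zero>" using v w by simp
    then show "x \<in> V <+>\<^bsub>R\<^esub> W" using x v(2) w(2) unfolding set_add_def' by blast
  qed
  show "W \<subseteq> V <+>\<^bsub>R\<^esub> W"
  proof
    fix x assume x: "x \<in> W"
    then have "x = \<zero> \<oplus> x" using v w by simp
    then show "x \<in> V <+>\<^bsub>R\<^esub> W" using x v(2) w(2) unfolding set_add_def' by blast
  qed
qed

lemma right_ideal_hom_zero:
  assumes "f \<in> right_ideal_hom R V W" "right_ideal V R" "right_ideal W R"
  shows "f \<zero> = \<zero>"
  using right_module_hom_zero[OF assms(1)] right_module_right_ideal_module[OF ring_axioms] assms
  by (simp add: right_ideal_module_def)

text \<open>
  Zorn's lemma, used below with \<open>D = {\<one>}\<close> for maximal right ideals and with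
  \<open>D = V - {\<zero>}\<close> for complements of \<open>V\<close>.
\<close>

lemma right_ideal_avoiding_maximal:
  assumes "right_ideal I R" "I \<inter> D = {}"
  obtains Q where "right_ideal Q R" "I \<subseteq> Q" "Q \<inter> D = {}"
    "\<And>Q'. right_ideal Q' R \<Longrightarrow> Q \<subseteq> Q' \<Longrightarrow> Q' \<inter> D = {} \<Longrightarrow> Q' = Q"
proof -
  let ?A = "{Q. right_ideal Q R \<and> I \<subseteq> Q \<and> Q \<inter> D = {}}"
  have "\<exists>M\<in>?A. \<forall>X\<in>?A. M \<subseteq> X \<longrightarrow> X = M"
  proof (rule subset_Zorn_nonempty)
    show "?A \<noteq> {}" using assms by blast
  next
    fix C assume "C \<noteq> {}" and chain: "subset.chain ?A C"
    then have C: "\<And>Q. Q \<in> C \<Longrightarrow> right_ideal Q R \<and> I \<subseteq> Q \<and> Q \<inter> D = {}"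
      and tot: "\<And>P Q. P \<in> C \<Longrightarrow> Q \<in> C \<Longrightarrow> P \<subseteq> Q \<or> Q \<subseteq> P"
      unfolding subset_chain_def by blast+
    have "right_ideal (\<Union>C) R"
    proof (rule right_idealI)
      show "\<Union>C \<subseteq> carrier R" using C right_idealD(1) by blast
      show "\<zero> \<in> \<Union>C" using C \<open>C \<noteq> {}\<close> right_idealD(2) by blast
    next
      fix x y assume "x \<in> \<Union>C" "y \<in> \<Union>C"
      then obtain P where "P \<in> C" "x \<in> P" "y \<in> P" using tot by blast
      then show "x \<oplus> y \<in> \<Union>C" using C right_idealD(4) by blast
    next
      fix x r assume "x \<in> \<Union>C" "r \<in> carrier R"
      then show "x \<otimes> r \<in> \<Union>C" using C right_idealD(5) by blast
    qed
    then show "\<Union>C \<in> ?A" using C \<open>C \<noteq> {}\<close> by blast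
  qed
  then obtain M where M: "M \<in> ?A" "\<forall>X\<in>?A. M \<subseteq> X \<longrightarrow> X = M" by (rule bexE)
  show thesis
  proof (rule that[of M])
    fix Q' assume "right_ideal Q' R" "M \<subseteq> Q'" "Q' \<inter> D = {}"
    then show "Q' = M" using M by blast
  qed (use M in auto)
qed

text \<open>
  The map \<open>v + q \<mapsto> v + (q + f v)\<close>, whose inverse is the shear along \<open>- f\<close>.
\<close>

lemma shear_automorphism:
  assumes V: "right_ideal V R" and Q: "right_ideal Q R" and VQ: "V \<inter> Q = {\<zero>}"
    and f: "f \<in> right_ideal_hom R V Q"
  obtains \<sigma> where "\<sigma> \<in> right_module_auto R (right_ideal_module R (V <+>\<^bsub>R\<^esub> Q))"
    "\<And>v. v \<in> V \<Longrightarrow> \<sigma> v = v \<oplus> f v" "\<And>q. q \<in> Q \<Longrightarrow> \<sigma> q = q"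
proof -
  note v = right_idealD[OF V] and q = right_idealD[OF Q] and fD = right_ideal_homD[OF f]
  define p where "p x = (THE a. a \<in> V \<and> (\<exists>b\<in>Q. x = a \<oplus> b))" for x
  have uniq: "a = c" if "a \<in> V" "c \<in> V" "b \<in> Q" "d \<in> Q" "a \<oplus> b = c \<oplus> d" for a b c d
  proof -
    have car: "a \<in> carrier R" "b \<in> carrier R" "c \<in> carrier R" "d \<in> carrier R"
      using that v q by auto
    have "a \<ominus> c = (a \<oplus> b) \<ominus> (c \<oplus> b)"
      using car by (simp add: minus_eq minus_add a_ac r_neg1 r_neg2 r_neg)
    also have "\<dots> = (c \<oplus> d) \<ominus> (c \<oplus> b)" by (simp add: that(5))
    also have "\<dots> = d \<ominus> b"
      using car by (simp add: minus_eq minus_add a_lcomm[of d "\<ominus> c"] a_assoc r_neg2)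
    finally have "a \<ominus> c = d \<ominus> b" .
    with v(7)[OF that(1,2)] q(7)[OF that(4,3)] have "a \<ominus> c \<in> V \<inter> Q" by simp
    then show ?thesis using VQ car minus_eq_zeroD by blast
  qed
  have p: "p (a \<oplus> b) = a" if "a \<in> V" "b \<in> Q" for a b
    unfolding p_def using that uniq by (intro the_equality) auto
  let ?\<sigma> = "\<lambda>x. x \<oplus> f (p x)" and ?\<tau> = "\<lambda>x. x \<ominus> f (p x)"
  have f0: "f \<zero> = \<zero>" by (rule right_ideal_hom_zero[OF f V Q])
  have dec: "\<And>x. x \<in> V <+>\<^bsub>R\<^esub> Q \<Longrightarrow> \<exists>a\<in>V. \<exists>b\<in>Q. x = a \<oplus> b" by (auto simp: set_add_def')
  have sumI: "\<And>a b. a \<in> V \<Longrightarrow> b \<in> Q \<Longrightarrow> a \<oplus> b \<in> V <+>\<^bsub>R\<^esub> Q" by (auto simp: set_add_def')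
  have \<sigma>ab: "?\<sigma> (a \<oplus> b) = a \<oplus> (b \<oplus> f a)" if "a \<in> V" "b \<in> Q" for a b
    using that v q fD by (simp add: p a_assoc)
  have \<tau>ab: "?\<tau> (a \<oplus> b) = a \<oplus> (b \<ominus> f a)" if "a \<in> V" "b \<in> Q" for a b
    using that v q fD by (simp add: p a_assoc minus_eq)
  have hom: "?\<sigma> \<in> right_ideal_hom R (V <+>\<^bsub>R\<^esub> Q) (V <+>\<^bsub>R\<^esub> Q)"
  proof (rule right_ideal_homI)
    fix x assume "x \<in> V <+>\<^bsub>R\<^esub> Q"
    with dec obtain a b where ab: "a \<in> V" "b \<in> Q" "x = a \<oplus> b" by blast
    show "?\<sigma> x \<in> V <+>\<^bsub>R\<^esub> Q" unfolding ab(3) \<sigma>ab[OF ab(1,2)] using ab fD q by (intro sumI) auto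
  next
    fix x y assume "x \<in> V <+>\<^bsub>R\<^esub> Q" "y \<in> V <+>\<^bsub>R\<^esub> Q"
    with dec obtain a b c d where
      ab: "a \<in> V" "b \<in> Q" "x = a \<oplus> b" and cd: "c \<in> V" "d \<in> Q" "y = c \<oplus> d" by meson
    have "x \<oplus> y = (a \<oplus> c) \<oplus> (b \<oplus> d)" using ab cd v q by (simp add: a_ac)
    then have "p (x \<oplus> y) = p x \<oplus> p y" using ab cd v q by (simp add: p)
    then show "?\<sigma> (x \<oplus> y) = ?\<sigma> x \<oplus> ?\<sigma> y"
      using ab cd v q fD by (simp add: p a_ac)
  next
    fix x r assume "x \<in> V <+>\<^bsub>R\<^esub> Q" and r: "r \<in> carrier R"
    with dec obtain a b where ab: "a \<in> V" "b \<in> Q" "x = a \<oplus> b" by blast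
    have "x \<otimes> r = a \<otimes> r \<oplus> b \<otimes> r" using ab r v q by (simp add: l_distr)
    then have "p (x \<otimes> r) = p x \<otimes> r" using ab r v q by (simp add: p)
    then show "?\<sigma> (x \<otimes> r) = ?\<sigma> x \<otimes> r"
      using ab r v q fD by (simp add: p l_distr)
  qed
  have "bij_betw ?\<sigma> (V <+>\<^bsub>R\<^esub> Q) (V <+>\<^bsub>R\<^esub> Q)"
  proof (rule bij_betw_byWitness[where f' = ?\<tau>])
    show "?\<sigma> ` (V <+>\<^bsub>R\<^esub> Q) \<subseteq> V <+>\<^bsub>R\<^esub> Q" using right_ideal_homD(1)[OF hom] by blast
    have "?\<tau> (a \<oplus> b) \<in> V <+>\<^bsub>R\<^esub> Q" if "a \<in> V" "b \<in> Q" for a b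
      unfolding \<tau>ab[OF that] using that fD q by (intro sumI) auto
    then show "?\<tau> ` (V <+>\<^bsub>R\<^esub> Q) \<subseteq> V <+>\<^bsub>R\<^esub> Q" using dec by blast
    have "?\<tau> (?\<sigma> (a \<oplus> b)) = a \<oplus> b \<and> ?\<sigma> (?\<tau> (a \<oplus> b)) = a \<oplus> b" if "a \<in> V" "b \<in> Q" for a b
    proof -
      have b': "b \<oplus> f a \<in> Q" "b \<ominus> f a \<in> Q" using that fD q by auto
      have "?\<tau> (?\<sigma> (a \<oplus> b)) = a \<oplus> ((b \<oplus> f a) \<ominus> f a)"
        unfolding \<sigma>ab[OF that] using \<tau>ab[OF that(1) b'(1)] .
      moreover have "?\<sigma> (?\<tau> (a \<oplus> b)) = a \<oplus> ((b \<ominus> f a) \<oplus> f a)"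
        unfolding \<tau>ab[OF that] using \<sigma>ab[OF that(1) b'(2)] .
      ultimately show ?thesis using that v q fD by (simp add: minus_eq a_assoc r_neg l_neg)
    qed
    then show "\<forall>x\<in>V <+>\<^bsub>R\<^esub> Q. ?\<tau> (?\<sigma> x) = x" "\<forall>x\<in>V <+>\<^bsub>R\<^esub> Q. ?\<sigma> (?\<tau> x) = x" using dec by blast+
  qed
  moreover have "?\<sigma> x = x \<oplus> f x" if "x \<in> V" for x
    using p[OF that q(2)] that v by simp
  moreover have "?\<sigma> x = x" if "x \<in> Q" for x
    using p[OF v(2) that] that q f0 by simp
  ultimately show thesis
    using that[of ?\<sigma>] hom by (auto simp: right_module_auto_def right_ideal_module_def)
qed

section \<open>Automorphism-invariance in terms of right ideals\<close>

text \<open>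
  The embedding \<open>\<iota>\<close> of \<open>M\<close> into its envelope \<open>E\<close> extends to \<open>N\<close> because \<open>E\<close> is injective, and the
  extension \<open>j\<close> remains injective because \<open>M\<close> is essential in \<open>N\<close>. Then \<open>\<sigma>\<close> extends to an
  automorphism of \<open>E\<close>, which preserves the image of \<open>M\<close>.
\<close>

lemma automorphism_invariant_right_ideal:
  assumes inv: "automorphism_invariant TYPE('e) R (right_ideal_module R M)"
    and ess: "essential_in R M N"
    and \<sigma>: "\<sigma> \<in> right_module_auto R (right_ideal_module R N)"
    and m: "m \<in> M"
  shows "\<sigma> m \<in> M"
proof -
  let ?M = "right_ideal_module R M" and ?N = "right_ideal_module R N"
  have M: "right_ideal M R" and N: "right_ideal N R" and MN: "M \<subseteq> N"
    using ess by (auto simp: essential_in_def)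
  note MD = right_idealD[OF M] and ND = right_idealD[OF N]
  have MM: "right_module R ?M" and NM: "right_module R ?N"
    using right_module_right_ideal_module[OF ring_axioms] M N by auto
  obtain E :: "('a, 'e) module" and \<iota> where env: "injective_envelope R ?M E \<iota>"
    and invE: "\<forall>\<phi> \<in> right_module_auto R E. \<phi> ` (\<iota> ` carrier ?M) \<subseteq> \<iota> ` carrier ?M"
    using inv unfolding automorphism_invariant_def by blast
  have E: "injective_right_module R E" and \<iota>: "\<iota> \<in> right_module_hom R ?M E"
    and \<iota>i: "inj_on \<iota> (carrier ?M)" and \<iota>e: "essential_submodule R (\<iota> ` carrier ?M) E"
    using env by (auto simp: injective_envelope_def)
  have EM: "right_module R E" using E by (simp add: injective_right_module_def)
  have car: "carrier ?M = M" "carrier ?N = N" "\<zero>\<^bsub>?M\<^esub> = \<zero>" "\<zero>\<^bsub>?N\<^esub> = \<zero>"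
    "\<And>r x. r \<odot>\<^bsub>?N\<^esub> x = x \<otimes> r"
    by (simp_all add: right_ideal_module_def)
  have incl: "(\<lambda>x. x) \<in> right_module_hom R ?M ?N"
    using MN by (intro right_module_homI) (auto simp: right_ideal_module_def)
  obtain j where j: "j \<in> right_module_hom R ?N E" and j\<iota>: "\<And>x. x \<in> carrier ?M \<Longrightarrow> j x = \<iota> x"
    by (rule injective_extend[OF E MM NM inj_Inl inj_Inl incl _ \<iota>]) auto
  have \<iota>0: "\<iota> \<zero> = \<zero>\<^bsub>E\<^esub>" using right_module_hom_zero[OF \<iota> MM EM] car by simp
  have ji: "inj_on j (carrier ?N)"
  proof (rule right_module_hom_inj_onI[OF j NM EM])
    fix x assume x: "x \<in> carrier ?N" "j x = \<zero>\<^bsub>E\<^esub>"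
    show "x = \<zero>\<^bsub>?N\<^esub>"
    proof (rule ccontr)
      assume "x \<noteq> \<zero>\<^bsub>?N\<^esub>"
      then obtain s where s: "s \<in> carrier R" "x \<otimes> s \<in> M" "x \<otimes> s \<noteq> \<zero>"
        using ess x car unfolding essential_in_def by (metis DiffE DiffI singleton_iff)
      interpret E: right_module R E by fact
      have "\<iota> (x \<otimes> s) = s \<odot>\<^bsub>E\<^esub> \<zero>\<^bsub>E\<^esub>"
        using right_module_homD(3)[OF j s(1) x(1)] j\<iota> s x car by simp
      also have "\<dots> = \<zero>\<^bsub>E\<^esub>" using E.smult_r_distr[of s "\<zero>\<^bsub>E\<^esub>" "\<zero>\<^bsub>E\<^esub>"] s by simp
      finally show False using \<iota>0 inj_onD[OF \<iota>i, of "x \<otimes> s" \<zero>] s MD car by auto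
    qed
  qed
  have jess: "\<exists>r\<in>carrier R. \<exists>n\<in>carrier ?N. n \<noteq> \<zero>\<^bsub>?N\<^esub> \<and> r \<odot>\<^bsub>E\<^esub> x = j n"
    if x: "x \<in> carrier E" "x \<noteq> \<zero>\<^bsub>E\<^esub>" for x
  proof -
    obtain r where r: "r \<in> carrier R" "r \<odot>\<^bsub>E\<^esub> x \<in> \<iota> ` carrier ?M" "r \<odot>\<^bsub>E\<^esub> x \<noteq> \<zero>\<^bsub>E\<^esub>"
      by (rule essential_submodule_meets[OF EM \<iota>e x])
    then obtain n where "n \<in> M" "r \<odot>\<^bsub>E\<^esub> x = \<iota> n" using car by auto
    then show ?thesis using r j\<iota> \<iota>0 MN car by (intro bexI[of _ r] bexI[of _ n]) auto
  qed
  obtain \<phi> where \<phi>: "\<phi> \<in> right_module_auto R E"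
    and \<phi>all: "\<forall>n\<in>carrier ?N. \<phi> (j n) = j (\<sigma> n)"
    using injective_extend_automorphism[OF E NM j ji jess \<sigma>] by (rule bexE)
  note \<phi>j = bspec[OF \<phi>all]
  have "j (\<sigma> m) = \<phi> (\<iota> m)" using \<phi>j[of m] j\<iota>[of m] m MN car by auto
  then have "j (\<sigma> m) \<in> \<iota> ` M" using bspec[OF invE \<phi>] m car by blast
  then obtain m' where m': "m' \<in> M" "j (\<sigma> m) = j m'" using j\<iota> car by auto
  have "\<sigma> m \<in> N" using \<sigma> m MN right_ideal_homD(1)[of \<sigma> R N N m] by (auto simp: right_module_auto_def)
  then show ?thesis using inj_onD[OF ji m'(2)] m' MN car by auto
qed

text \<open>
  The automorphism of the envelope of \<open>R\<close> that extends \<open>\<sigma>\<close> maps \<open>\<one>\<close> to an element of \<open>R\<close>; this is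
  the element \<open>d\<close>.
\<close>

lemma automorphism_invariant_left_mult:
  assumes inv: "automorphism_invariant TYPE('e) R (right_ideal_module R (carrier R))"
    and ess: "essential_in R N (carrier R)"
    and \<sigma>: "\<sigma> \<in> right_module_auto R (right_ideal_module R N)"
  obtains d where "d \<in> carrier R" "\<And>n. n \<in> N \<Longrightarrow> \<sigma> n = d \<otimes> n"
proof -
  let ?R = "right_ideal_module R (carrier R)" and ?N = "right_ideal_module R N"
  have N: "right_ideal N R" using ess by (auto simp: essential_in_def)
  note ND = right_idealD[OF N]
  have RM: "right_module R ?R" and NM: "right_module R ?N"
    using right_module_right_ideal_module[OF ring_axioms] right_ideal_carrier N by auto
  obtain E :: "('a, 'e) module" and \<iota> where env: "injective_envelope R ?R E \<iota>"
    and invE: "\<forall>\<phi> \<in> right_module_auto R E. \<phi> ` (\<iota> ` carrier ?R) \<subseteq> \<iota> ` carrier ?R"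
    using inv unfolding automorphism_invariant_def by blast
  have E: "injective_right_module R E" and \<iota>: "\<iota> \<in> right_module_hom R ?R E"
    and \<iota>i: "inj_on \<iota> (carrier ?R)" and \<iota>e: "essential_submodule R (\<iota> ` carrier ?R) E"
    using env by (auto simp: injective_envelope_def)
  have EM: "right_module R E" using E by (simp add: injective_right_module_def)
  have car: "carrier ?R = carrier R" "carrier ?N = N" "\<zero>\<^bsub>?R\<^esub> = \<zero>" "\<zero>\<^bsub>?N\<^esub> = \<zero>"
    "\<And>r x. r \<odot>\<^bsub>?N\<^esub> x = x \<otimes> r" "\<And>r x. r \<odot>\<^bsub>?R\<^esub> x = x \<otimes> r"
    by (simp_all add: right_ideal_module_def)
  have "(\<lambda>x. x) \<in> right_module_hom R ?N ?R"
    using ND by (intro right_module_homI) (auto simp: right_ideal_module_def)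
  from right_module_hom_compose[OF this \<iota>] have j: "\<iota> \<in> right_module_hom R ?N E" by simp
  have ji: "inj_on \<iota> (carrier ?N)" using \<iota>i ND car by (simp add: inj_on_subset)
  have \<iota>0: "\<iota> \<zero> = \<zero>\<^bsub>E\<^esub>" using right_module_hom_zero[OF \<iota> RM EM] car by simp
  interpret E: right_module R E by fact
  have jess: "\<exists>r\<in>carrier R. \<exists>n\<in>carrier ?N. n \<noteq> \<zero>\<^bsub>?N\<^esub> \<and> r \<odot>\<^bsub>E\<^esub> x = \<iota> n"
    if x: "x \<in> carrier E" "x \<noteq> \<zero>\<^bsub>E\<^esub>" for x
  proof -
    obtain r where r: "r \<in> carrier R" "r \<odot>\<^bsub>E\<^esub> x \<in> \<iota> ` carrier ?R" "r \<odot>\<^bsub>E\<^esub> x \<noteq> \<zero>\<^bsub>E\<^esub>"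
      by (rule essential_submodule_meets[OF EM \<iota>e x])
    then obtain y where y: "y \<in> carrier R" "r \<odot>\<^bsub>E\<^esub> x = \<iota> y" using car by auto
    then have "y \<noteq> \<zero>" using r \<iota>0 by auto
    then obtain s where s: "s \<in> carrier R" "y \<otimes> s \<in> N" "y \<otimes> s \<noteq> \<zero>"
      using ess y unfolding essential_in_def by (metis DiffE DiffI singleton_iff)
    have "(r \<otimes> s) \<odot>\<^bsub>E\<^esub> x = \<iota> (y \<otimes> s)"
      using E.smult_assoc[OF r(1) s(1) x(1)] right_module_homD(3)[OF \<iota> s(1), of y] y car by simp
    then show ?thesis using r s car by (intro bexI[of _ "r \<otimes> s"] bexI[of _ "y \<otimes> s"]) auto
  qed
  obtain \<phi> where \<phi>: "\<phi> \<in> right_module_auto R E"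
    and \<phi>all: "\<forall>n\<in>carrier ?N. \<phi> (\<iota> n) = \<iota> (\<sigma> n)"
    using injective_extend_automorphism[OF E NM j ji jess \<sigma>] by (rule bexE)
  note \<phi>j = bspec[OF \<phi>all]
  have \<phi>h: "\<phi> \<in> right_module_hom R E E" using \<phi> by (simp add: right_module_auto_def)
  have "\<phi> (\<iota> \<one>) \<in> \<iota> ` carrier R" using bspec[OF invE \<phi>] car by auto
  then obtain d where d: "d \<in> carrier R" "\<phi> (\<iota> \<one>) = \<iota> d" by blast
  have "\<sigma> n = d \<otimes> n" if n: "n \<in> N" for n
  proof -
    have nc: "n \<in> carrier R" using n ND by blast
    have "\<iota> (\<sigma> n) = \<phi> (n \<odot>\<^bsub>E\<^esub> \<iota> \<one>)"
      using \<phi>j[of n] right_module_homD(3)[OF \<iota> nc, of \<one>] n nc car by simp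
    also have "\<dots> = n \<odot>\<^bsub>E\<^esub> \<iota> d"
      using right_module_homD(3)[OF \<phi>h nc] right_module_homD(1)[OF \<iota>] d car by simp
    also have "\<dots> = \<iota> (d \<otimes> n)" using right_module_homD(3)[OF \<iota> nc, of d] d car by simp
    finally have "\<iota> (\<sigma> n) = \<iota> (d \<otimes> n)" .
    moreover have "\<sigma> n \<in> N" using \<sigma> n right_ideal_homD(1)[of \<sigma> R N N n] by (auto simp: right_module_auto_def)
    ultimately show ?thesis using inj_onD[OF \<iota>i] ND d nc car by auto
  qed
  with d show thesis using that by blast
qed

end

section \<open>Independent isomorphic right ideals\<close>

definition twin_ideals ::
    "('a, 'm) ring_scheme \<Rightarrow> 'a set \<Rightarrow> 'a set \<Rightarrow> ('a \<Rightarrow> 'a) \<Rightarrow> bool" where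
  "twin_ideals R V V' f \<longleftrightarrow> right_ideal V R \<and> right_ideal V' R \<and> V \<inter> V' = {\<zero>\<^bsub>R\<^esub>} \<and>
     f \<in> right_ideal_hom R V V' \<and> bij_betw f V V'"

text \<open>
  The rest of the proof uses the right a-ring property only through these two consequences, which
  speak of right ideals instead of envelopes.
\<close>

locale a_ring = ring +
  assumes automorphism_stable: "essential_in R M N \<Longrightarrow>
      \<sigma> \<in> right_module_auto R (right_ideal_module R N) \<Longrightarrow> m \<in> M \<Longrightarrow> \<sigma> m \<in> M"
    and automorphism_left_mult: "essential_in R N (carrier R) \<Longrightarrow>
      \<sigma> \<in> right_module_auto R (right_ideal_module R N) \<Longrightarrow>
      \<exists>d\<in>carrier R. \<forall>n\<in>N. \<sigma> n = d \<otimes> n"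

lemma a_ring_right_a_ring:
  assumes "right_a_ring TYPE('e) R"
  shows "a_ring R"
proof -
  interpret ring R using assms by (simp add: right_a_ring_def)
  have inv: "automorphism_invariant TYPE('e) R (right_ideal_module R I)" if "right_ideal I R" for I
    using assms that by (simp add: right_a_ring_def)
  show ?thesis
  proof unfold_locales
    fix M N \<sigma> m
    assume ess: "essential_in R M N"
      and \<sigma>: "\<sigma> \<in> right_module_auto R (right_ideal_module R N)" and m: "m \<in> M"
    have "right_ideal M R" using ess by (simp add: essential_in_def)
    from automorphism_invariant_right_ideal[OF inv[OF this] ess \<sigma> m] show "\<sigma> m \<in> M" .
  next
    fix N \<sigma>
    assume "essential_in R N (carrier R)" "\<sigma> \<in> right_module_auto R (right_ideal_module R N)"
    then show "\<exists>d\<in>carrier R. \<forall>n\<in>N. \<sigma> n = d \<otimes>\<^bsub>R\<^esub> n"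
      using automorphism_invariant_left_mult[OF inv[OF right_ideal_carrier]] by metis
  qed
qed

context ring
begin

lemma essential_inE:
  assumes "essential_in R W V" "v \<in> V" "v \<noteq> \<zero>"
  obtains s where "s \<in> carrier R" "v \<otimes> s \<in> W" "v \<otimes> s \<noteq> \<zero>"
  using assms unfolding essential_in_def by blast

lemma essential_inI:
  assumes "right_ideal W R" "right_ideal V R" "W \<subseteq> V"
    and "\<And>v. v \<in> V \<Longrightarrow> v \<noteq> \<zero> \<Longrightarrow> \<exists>s\<in>carrier R. v \<otimes> s \<in> W \<and> v \<otimes> s \<noteq> \<zero>"
  shows "essential_in R W V"
  using assms unfolding essential_in_def by blast

lemma twin_idealsD:
  assumes "twin_ideals R V V' f"
  shows "right_ideal V R" "right_ideal V' R" "V \<inter> V' = {\<zero>}" "f \<in> right_ideal_hom R V V'"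
    "bij_betw f V V'"
  using assms by (auto simp: twin_ideals_def)

lemma twin_ideals_sym:
  assumes "twin_ideals R V V' f"
  shows "twin_ideals R V' V (inv_into V f)"
proof -
  note t = twin_idealsD[OF assms] and fD = right_ideal_homD[OF twin_idealsD(4)[OF assms]]
  have inj: "inj_on f V" and im: "f ` V = V'" using t(5) by (auto simp: bij_betw_def)
  have gf: "\<And>v. v \<in> V \<Longrightarrow> inv_into V f (f v) = v" using inj by simp
  have hom: "inv_into V f \<in> right_ideal_hom R V' V"
  proof (rule right_ideal_homI)
    fix x assume "x \<in> V'"
    then show "inv_into V f x \<in> V" using im inv_into_into by metis
  next
    fix x y assume "x \<in> V'" "y \<in> V'"
    then obtain a b where "a \<in> V" "b \<in> V" "x = f a" "y = f b" using im by blast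
    then show "inv_into V f (x \<oplus> y) = inv_into V f x \<oplus> inv_into V f y"
      using gf right_idealD(4)[OF t(1)] by (simp add: fD(2)[symmetric])
  next
    fix x r assume "x \<in> V'" "r \<in> carrier R"
    then obtain a where "a \<in> V" "x = f a" using im by blast
    then show "inv_into V f (x \<otimes> r) = inv_into V f x \<otimes> r"
      using gf right_idealD(5)[OF t(1)] \<open>r \<in> carrier R\<close> by (simp add: fD(3)[symmetric])
  qed
  show ?thesis unfolding twin_ideals_def
    using t hom bij_betw_inv_into[OF t(5)] by blast
qed

end

context a_ring
begin

text \<open>
  If \<open>W\<close> is essential in \<open>V\<close>, then \<open>V' + W\<close> is essential in \<open>V' + V\<close>, so it is stable under the
  shear \<open>v' \<mapsto> v' + f\<^sup>-\<^sup>1 v'\<close>. Hence \<open>f x + x\<close> lies in \<open>V' + W\<close> for \<open>x \<in> V\<close>, and comparing the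
  components in \<open>V\<close> gives \<open>x \<in> W\<close>.
\<close>

lemma twin_no_proper_essential:
  assumes t: "twin_ideals R V V' f" and ess: "essential_in R W V"
  shows "W = V"
proof -
  note T = twin_idealsD[OF t] and S = twin_idealsD[OF twin_ideals_sym[OF t]]
  let ?g = "inv_into V f"
  note v = right_idealD[OF T(1)] and v' = right_idealD[OF T(2)]
  have W: "right_ideal W R" and WV: "W \<subseteq> V" using ess by (auto simp: essential_in_def)
  note w = right_idealD[OF W] and sN = right_ideal_sum[OF T(2) T(1)] and sM = right_ideal_sum[OF T(2) W]
  have indep: "b = \<zero>" if "a \<in> V'" "b \<in> V" "a \<oplus> b = \<zero>" for a b
  proof -
    have "\<ominus> a = b" using that v v' by (intro minus_equality) (auto simp: a_comm)
    then have "b \<in> V \<inter> V'" using that v'(6)[of a] by simp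
    then show ?thesis using T(3) by blast
  qed
  have essMN: "essential_in R (V' <+>\<^bsub>R\<^esub> W) (V' <+>\<^bsub>R\<^esub> V)"
  proof (rule essential_inI)
    show "V' <+>\<^bsub>R\<^esub> W \<subseteq> V' <+>\<^bsub>R\<^esub> V" using WV by (auto simp: set_add_def')
    fix x assume "x \<in> V' <+>\<^bsub>R\<^esub> V" and x0: "x \<noteq> \<zero>"
    then obtain a b where ab: "a \<in> V'" "b \<in> V" "x = a \<oplus> b" by (auto simp: set_add_def')
    show "\<exists>s\<in>carrier R. x \<otimes> s \<in> V' <+>\<^bsub>R\<^esub> W \<and> x \<otimes> s \<noteq> \<zero>"
    proof (cases "b = \<zero>")
      case True
      then have "x = a" using ab v' by simp
      then show ?thesis using ab x0 sM v' by (intro bexI[of _ \<one>]) auto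
    next
      case False
      then obtain s where s: "s \<in> carrier R" "b \<otimes> s \<in> W" "b \<otimes> s \<noteq> \<zero>"
        using essential_inE[OF ess ab(2)] by blast
      have xs: "x \<otimes> s = a \<otimes> s \<oplus> b \<otimes> s" using ab s v v' by (simp add: l_distr)
      have "a \<otimes> s \<in> V'" using ab s v' by simp
      then have "x \<otimes> s \<in> V' <+>\<^bsub>R\<^esub> W" "x \<otimes> s \<noteq> \<zero>"
        using indep[of "a \<otimes> s" "b \<otimes> s"] s WV unfolding xs set_add_def' by blast+
      then show ?thesis using s by blast
    qed
  qed (use sN sM in auto)
  have "V' \<inter> V = {\<zero>}" using T(3) by blast
  then obtain \<sigma> where \<sigma>: "\<sigma> \<in> right_module_auto R (right_ideal_module R (V' <+>\<^bsub>R\<^esub> V))"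
    and \<sigma>v': "\<And>x. x \<in> V' \<Longrightarrow> \<sigma> x = x \<oplus> ?g x"
    using shear_automorphism[OF T(2) T(1) _ S(4)] by metis
  have "V \<subseteq> W"
  proof
    fix x assume x: "x \<in> V"
    have fx: "f x \<in> V'" using x right_ideal_homD(1)[OF T(4)] by blast
    have gx: "?g (f x) = x" using x T(5) by (simp add: bij_betw_def)
    have "\<sigma> (f x) \<in> V' <+>\<^bsub>R\<^esub> W"
      using automorphism_stable[OF essMN \<sigma>] sM fx by blast
    then obtain a b where ab: "a \<in> V'" "b \<in> W" "f x \<oplus> x = a \<oplus> b"
      using \<sigma>v'[OF fx] gx by (auto simp: set_add_def')
    have car: "f x \<in> carrier R" "x \<in> carrier R" "a \<in> carrier R" "b \<in> carrier R"
      using fx x ab v v' w by auto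
    have "(f x \<ominus> a) \<oplus> (x \<ominus> b) = (f x \<oplus> x) \<ominus> (a \<oplus> b)"
      using car by (simp add: minus_eq minus_add a_ac)
    also have "\<dots> = \<zero>" using ab(3) car by (simp add: minus_self)
    finally have "(f x \<ominus> a) \<oplus> (x \<ominus> b) = \<zero>" .
    from indep[OF v'(7)[OF fx ab(1)] v(7)[OF x subsetD[OF WV ab(2)]] this]
    have "x \<ominus> b = \<zero>" .
    then show "x \<in> W" using minus_eq_zeroD car ab by blast
  qed
  then show ?thesis using WV by blast
qed

text \<open>
  Let \<open>Q \<supseteq> V'\<close> be maximal with \<open>Q \<inter> V = 0\<close>. Then \<open>V + Q\<close> is essential in \<open>R\<close>, so its shear along
  \<open>f\<close> is left multiplication by some \<open>d\<close>, and \<open>a = d - \<one>\<close> agrees with \<open>f\<close> on \<open>V\<close> and kills \<open>Q\<close>.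
  It is the maximality of \<open>Q\<close> that makes \<open>V'\<close> essential in \<open>a R\<close>: if \<open>a x \<noteq> \<zero>\<close>, then \<open>x \<notin> Q\<close>, so
  \<open>Q + x R\<close> contains a nonzero element of \<open>V\<close>, and \<open>a\<close> maps it to a nonzero multiple of \<open>a x\<close> in
  \<open>V'\<close>.
\<close>

lemma twin_left_mult:
  assumes t: "twin_ideals R V V' f"
  obtains a where "a \<in> carrier R" "\<And>v. v \<in> V \<Longrightarrow> a \<otimes> v = f v"
    "essential_in R V' ((\<lambda>r. a \<otimes> r) ` carrier R)"
proof -
  note T = twin_idealsD[OF t] and fD = right_ideal_homD[OF twin_idealsD(4)[OF t]]
  note v = right_idealD[OF T(1)] and v' = right_idealD[OF T(2)]
  obtain Q where Q: "right_ideal Q R" "V' \<subseteq> Q" "Q \<inter> (V - {\<zero>}) = {}"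
    and max: "\<And>Q'. right_ideal Q' R \<Longrightarrow> Q \<subseteq> Q' \<Longrightarrow> Q' \<inter> (V - {\<zero>}) = {} \<Longrightarrow> Q' = Q"
    using right_ideal_avoiding_maximal[OF T(2), of "V - {\<zero>}"] T(3) by blast
  note q = right_idealD[OF Q(1)]
  have VQ: "V \<inter> Q = {\<zero>}" using Q q v by blast
  have meet: "\<exists>s\<in>carrier R. \<exists>b\<in>Q. b \<oplus> x \<otimes> s \<in> V \<and> b \<oplus> x \<otimes> s \<noteq> \<zero>"
    if x: "x \<in> carrier R" "x \<notin> Q" for x
  proof -
    have s: "right_ideal (Q <+>\<^bsub>R\<^esub> (\<lambda>r. x \<otimes> r) ` carrier R) R"
      "Q \<subseteq> Q <+>\<^bsub>R\<^esub> (\<lambda>r. x \<otimes> r) ` carrier R"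
      "(\<lambda>r. x \<otimes> r) ` carrier R \<subseteq> Q <+>\<^bsub>R\<^esub> (\<lambda>r. x \<otimes> r) ` carrier R"
      using right_ideal_sum[OF Q(1) right_ideal_cyclic[OF x(1)]] by auto
    have "x \<in> (\<lambda>r. x \<otimes> r) ` carrier R" using x by (intro image_eqI[of _ _ \<one>]) auto
    then have "(Q <+>\<^bsub>R\<^esub> (\<lambda>r. x \<otimes> r) ` carrier R) \<inter> (V - {\<zero>}) \<noteq> {}"
      using max[OF s(1,2)] s(3) x(2) by blast
    then show ?thesis unfolding set_add_def' by blast
  qed
  note sN = right_ideal_sum[OF T(1) Q(1)]
  have ess: "essential_in R (V <+>\<^bsub>R\<^esub> Q) (carrier R)"
  proof (rule essential_inI[OF sN(1) right_ideal_carrier])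
    show "V <+>\<^bsub>R\<^esub> Q \<subseteq> carrier R" using right_idealD(1)[OF sN(1)] .
    fix x assume x: "x \<in> carrier R" "x \<noteq> \<zero>"
    show "\<exists>s\<in>carrier R. x \<otimes> s \<in> V <+>\<^bsub>R\<^esub> Q \<and> x \<otimes> s \<noteq> \<zero>"
    proof (cases "x \<in> Q")
      case True
      then show ?thesis using x sN(3) by (intro bexI[of _ \<one>]) auto
    next
      case False
      then obtain s b where sb: "s \<in> carrier R" "b \<in> Q" "b \<oplus> x \<otimes> s \<in> V" "b \<oplus> x \<otimes> s \<noteq> \<zero>"
        using meet x by blast
      have xs: "x \<otimes> s = (b \<oplus> x \<otimes> s) \<oplus> \<ominus> b"
        using sb x q by (simp add: a_ac r_neg1 r_neg2)
      moreover have "(b \<oplus> x \<otimes> s) \<oplus> \<ominus> b \<in> V <+>\<^bsub>R\<^esub> Q"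
        using sb(3) q(6)[OF sb(2)] unfolding set_add_def' by blast
      ultimately have "x \<otimes> s \<in> V <+>\<^bsub>R\<^esub> Q" by simp
      moreover have "x \<otimes> s \<noteq> \<zero>" using sb VQ q by auto
      ultimately show ?thesis using sb by blast
    qed
  qed
  have "f \<in> right_ideal_hom R V Q" using fD Q(2) by (intro right_ideal_homI) auto
  then obtain \<sigma> where \<sigma>: "\<sigma> \<in> right_module_auto R (right_ideal_module R (V <+>\<^bsub>R\<^esub> Q))"
    and \<sigma>v: "\<And>x. x \<in> V \<Longrightarrow> \<sigma> x = x \<oplus> f x" and \<sigma>q: "\<And>x. x \<in> Q \<Longrightarrow> \<sigma> x = x"
    using shear_automorphism[OF T(1) Q(1) VQ] by metis
  obtain d where d: "d \<in> carrier R" and \<sigma>d: "\<And>n. n \<in> V <+>\<^bsub>R\<^esub> Q \<Longrightarrow> \<sigma> n = d \<otimes> n"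
    using automorphism_left_mult[OF ess \<sigma>] by blast
  define a where "a = d \<ominus> \<one>"
  have a: "a \<in> carrier R" using d by (simp add: a_def)
  have av: "a \<otimes> x = f x" if x: "x \<in> V" for x
  proof -
    have car: "x \<in> carrier R" "f x \<in> carrier R" using x v v' fD by auto
    have "d \<otimes> x = x \<oplus> f x" using \<sigma>d[OF subsetD[OF sN(2) x]] \<sigma>v[OF x] by simp
    then have "a \<otimes> x = (x \<oplus> f x) \<ominus> x" using car d by (simp add: a_def minus_distr_left)
    then show ?thesis using car by (simp add: minus_eq a_comm[of x "f x"] a_assoc r_neg)
  qed
  have aq: "a \<otimes> x = \<zero>" if x: "x \<in> Q" for x
  proof -
    have car: "x \<in> carrier R" using x q by auto
    have "d \<otimes> x = x" using \<sigma>d[OF subsetD[OF sN(3) x]] \<sigma>q[OF x] by simp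
    then show ?thesis using car d by (simp add: a_def minus_distr_left minus_self)
  qed
  have "essential_in R V' ((\<lambda>r. a \<otimes> r) ` carrier R)"
  proof (rule essential_inI[OF T(2) right_ideal_cyclic[OF a]])
    show "V' \<subseteq> (\<lambda>r. a \<otimes> r) ` carrier R"
    proof
      fix y assume "y \<in> V'"
      then obtain x where "x \<in> V" "y = f x" using T(5) by (auto simp: bij_betw_def)
      then show "y \<in> (\<lambda>r. a \<otimes> r) ` carrier R" using av v by (intro image_eqI[of _ _ x]) auto
    qed
    fix y assume "y \<in> (\<lambda>r. a \<otimes> r) ` carrier R" and y0: "y \<noteq> \<zero>"
    then obtain x where x: "x \<in> carrier R" "y = a \<otimes> x" by blast
    then have "x \<notin> Q" using y0 aq by auto
    then obtain s b where sb: "s \<in> carrier R" "b \<in> Q" "b \<oplus> x \<otimes> s \<in> V" "b \<oplus> x \<otimes> s \<noteq> \<zero>"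
      using meet x by blast
    have "f (b \<oplus> x \<otimes> s) = a \<otimes> (b \<oplus> x \<otimes> s)" using av sb by simp
    also have "\<dots> = y \<otimes> s" using sb x a q aq by (simp add: r_distr m_assoc)
    finally have ys: "y \<otimes> s = f (b \<oplus> x \<otimes> s)" ..
    have "f \<zero> = \<zero>" by (rule right_ideal_hom_zero[OF T(4) T(1,2)])
    then have "y \<otimes> s \<noteq> \<zero>"
      using ys T(5) sb v(2) unfolding bij_betw_def by (metis inj_onD)
    moreover have "y \<otimes> s \<in> V'" using ys fD(1)[OF sb(3)] by simp
    ultimately show "\<exists>s\<in>carrier R. y \<otimes> s \<in> V' \<and> y \<otimes> s \<noteq> \<zero>" using sb(1) by blast
  qed
  then show thesis using that a av by blast
qed

text \<open>
  Let \<open>a\<close> and \<open>b\<close> induce \<open>f\<close> and its inverse. Since \<open>V'\<close> is essential in \<open>a R\<close>, and \<open>V\<close> is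
  essential in \<open>b R\<close>, the right ideals \<open>a R\<close> and \<open>b a R\<close> are again independent and isomorphic.
  So \<open>V'\<close> cannot be a proper essential right subideal of \<open>a R\<close>. Thus \<open>a \<in> V'\<close>, and \<open>g = b a\<close>
  lies in \<open>V\<close>.
\<close>

lemma twin_generator:
  assumes t: "twin_ideals R V V' f"
  obtains g where "g \<in> V" "\<And>v. v \<in> V \<Longrightarrow> g \<otimes> v = v"
proof -
  let ?g = "inv_into V f"
  note ts = twin_ideals_sym[OF t]
  note T = twin_idealsD[OF t] and S = twin_idealsD[OF ts]
  note v = right_idealD[OF T(1)] and v' = right_idealD[OF T(2)]
  obtain a where a: "a \<in> carrier R" "\<And>x. x \<in> V \<Longrightarrow> a \<otimes> x = f x"
    and aess: "essential_in R V' ((\<lambda>r. a \<otimes> r) ` carrier R)"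
    using twin_left_mult[OF t] by blast
  obtain b where b: "b \<in> carrier R" "\<And>x. x \<in> V' \<Longrightarrow> b \<otimes> x = ?g x"
    and bess: "essential_in R V ((\<lambda>r. b \<otimes> r) ` carrier R)"
    using twin_left_mult[OF ts] by blast
  have bf: "b \<otimes> (a \<otimes> x) = x" if "x \<in> V" for x
    using that a b T(5) right_ideal_homD(1)[OF T(4)] by (simp add: bij_betw_def)
  let ?A = "(\<lambda>r. a \<otimes> r) ` carrier R"
  let ?B = "(\<lambda>x. b \<otimes> x) ` ?A"
  have A: "right_ideal ?A R" by (rule right_ideal_cyclic[OF a(1)])
  note AD = right_idealD[OF A]
  have B: "right_ideal ?B R" by (rule right_ideal_left_mult[OF b(1) A])
  have binj: "x = \<zero>" if x: "x \<in> ?A" "b \<otimes> x = \<zero>" for x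
  proof (rule ccontr)
    assume "x \<noteq> \<zero>"
    then obtain s where s: "s \<in> carrier R" "x \<otimes> s \<in> V'" "x \<otimes> s \<noteq> \<zero>"
      using essential_inE[OF aess x(1)] by blast
    have xc: "x \<in> carrier R" using x AD by blast
    have "?g (x \<otimes> s) = b \<otimes> (x \<otimes> s)" using b s by simp
    also have "\<dots> = (b \<otimes> x) \<otimes> s" using b(1) xc s(1) by (simp add: m_assoc)
    also have "\<dots> = \<zero>" using x s by simp
    finally have "?g (x \<otimes> s) = ?g \<zero>" using right_ideal_hom_zero[OF S(4) S(1,2)] by simp
    then show False using S(5) s v'(2) unfolding bij_betw_def by (metis inj_onD)
  qed
  have "twin_ideals R ?A ?B (\<lambda>x. b \<otimes> x)"
    unfolding twin_ideals_def
  proof (intro conjI A B)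
    show "?A \<inter> ?B = {\<zero>}"
    proof (intro equalityI subsetI)
      fix y assume y: "y \<in> ?A \<inter> ?B"
      have "y = \<zero>"
      proof (rule ccontr)
        assume y0: "y \<noteq> \<zero>"
        have "?B \<subseteq> (\<lambda>r. b \<otimes> r) ` carrier R" using AD by auto
        with y have "y \<in> (\<lambda>r. b \<otimes> r) ` carrier R" by (meson IntD2 subsetD)
        from essential_inE[OF bess this y0]
        obtain s where s: "s \<in> carrier R" "y \<otimes> s \<in> V" "y \<otimes> s \<noteq> \<zero>" .
        have "y \<otimes> s \<in> ?A" using AD(5)[OF IntD1[OF y] s(1)] .
        from essential_inE[OF aess this s(3)]
        obtain t where t: "t \<in> carrier R" "(y \<otimes> s) \<otimes> t \<in> V'" "(y \<otimes> s) \<otimes> t \<noteq> \<zero>" .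
        have "(y \<otimes> s) \<otimes> t \<in> V" using v(5) s t by blast
        then show False using t T(3) by blast
      qed
      then show "y \<in> {\<zero>}" by simp
    next
      fix y assume "y \<in> {\<zero>}"
      then show "y \<in> ?A \<inter> ?B" using AD(2) right_idealD(2)[OF B] by simp
    qed
    show hom: "(\<lambda>x. b \<otimes> x) \<in> right_ideal_hom R ?A ?B"
      using b AD(3) by (intro right_ideal_homI) (blast, simp_all add: r_distr m_assoc)
    have "inj_on (\<lambda>x. b \<otimes> x) ?A"
    proof (rule inj_onI)
      fix x y assume xy: "x \<in> ?A" "y \<in> ?A" "b \<otimes> x = b \<otimes> y"
      have car: "x \<in> carrier R" "y \<in> carrier R" using xy AD by blast+
      have "b \<otimes> (x \<ominus> y) = \<zero>" using car b xy(3) by (simp add: minus_distr_right minus_self)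
      then have "x \<ominus> y = \<zero>" by (rule binj[OF AD(7)[OF xy(1,2)]])
      then show "x = y" using car minus_eq_zeroD by blast
    qed
    then show "bij_betw (\<lambda>x. b \<otimes> x) ?A ?B" by (rule inj_on_imp_bij_betw)
  qed
  from twin_no_proper_essential[OF this aess] have VA: "V' = ?A" .
  have aV: "a \<in> V'" unfolding VA using a by (intro image_eqI[of _ _ \<one>]) auto
  have "b \<otimes> a \<in> V" using b aV right_ideal_homD(1)[OF S(4)] by simp
  moreover have "(b \<otimes> a) \<otimes> x = x" if "x \<in> V" for x
    using bf[OF that] a(1) b(1) v(3)[OF that] by (simp add: m_assoc)
  ultimately show thesis using that by blast
qed

end

section \<open>Families that are free modulo a right ideal\<close>

text \<open>
  The annihilator of the coset of \<open>r\<close> in \<open>R / A\<close>, so that \<open>R\<close> modulo this right ideal is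
  isomorphic to the cyclic submodule \<open>(r R + A) / A\<close>.
\<close>

definition right_quotient :: "('a, 'm) ring_scheme \<Rightarrow> 'a set \<Rightarrow> 'a \<Rightarrow> 'a set" where
  "right_quotient R A r = {s \<in> carrier R. r \<otimes>\<^bsub>R\<^esub> s \<in> A}"

text \<open>
  Maximality is expressed by simplicity of \<open>R / A\<close>: every nonzero coset generates \<open>R / A\<close>.
\<close>

definition maximal_right_ideal :: "('a, 'm) ring_scheme \<Rightarrow> 'a set \<Rightarrow> bool" where
  "maximal_right_ideal R A \<longleftrightarrow> right_ideal A R \<and> \<one>\<^bsub>R\<^esub> \<notin> A \<and>
     (\<forall>s\<in>carrier R - A. \<exists>t\<in>carrier R. s \<otimes>\<^bsub>R\<^esub> t \<ominus>\<^bsub>R\<^esub> \<one>\<^bsub>R\<^esub> \<in> A)"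

text \<open>
  The vectors \<open>v j\<close> with \<open>j \<in> S\<close>, restricted to the coordinates in \<open>I\<close>, generate independent
  submodules of \<open>R\<^sup>I\<close>, and each of them is isomorphic to \<open>R / A\<close> by \<open>r \<mapsto> v j r\<close>. The coefficient
  functions are total so that no closure conditions have to be restricted to \<open>F\<close>.
\<close>

definition free_modulo ::
    "('a, 'm) ring_scheme \<Rightarrow> 'a set \<Rightarrow> 'i set \<Rightarrow> 'j set \<Rightarrow> ('j \<Rightarrow> 'i \<Rightarrow> 'a) \<Rightarrow> bool" where
  "free_modulo R A I S v \<longleftrightarrow>
     (\<forall>F r. finite F \<longrightarrow> F \<subseteq> S \<longrightarrow> (\<forall>j. r j \<in> carrier R) \<longrightarrow>
        ((\<forall>i\<in>I. (\<Oplus>\<^bsub>R\<^esub>j\<in>F. v j i \<otimes>\<^bsub>R\<^esub> r j) = \<zero>\<^bsub>R\<^esub>) \<longleftrightarrow> (\<forall>j\<in>F. r j \<in> A)))"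

lemma free_moduloD:
  assumes "free_modulo R A I S v" "finite F" "F \<subseteq> S" "\<And>j. r j \<in> carrier R"
  shows "(\<forall>i\<in>I. (\<Oplus>\<^bsub>R\<^esub>j\<in>F. v j i \<otimes>\<^bsub>R\<^esub> r j) = \<zero>\<^bsub>R\<^esub>) \<longleftrightarrow> (\<forall>j\<in>F. r j \<in> A)"
  using assms unfolding free_modulo_def by blast

lemma free_modulo_subset:
  assumes "free_modulo R A I S v" "T \<subseteq> S"
  shows "free_modulo R A I T v"
  using assms unfolding free_modulo_def by (meson subset_trans)

context ring
begin

lemma right_ideal_right_quotient:
  assumes A: "right_ideal A R" and r: "r \<in> carrier R"
  shows "right_ideal (right_quotient R A r) R"
  using r right_idealD[OF A]
  by (intro right_idealI) (auto simp: right_quotient_def r_distr m_assoc[symmetric])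

lemma right_quotient_right_quotient:
  assumes "r \<in> carrier R" "s \<in> carrier R"
  shows "right_quotient R (right_quotient R A r) s = right_quotient R A (r \<otimes> s)"
  using assms by (auto simp: right_quotient_def m_assoc)

lemma right_quotient_one: "right_ideal A R \<Longrightarrow> right_quotient R A \<one> = A"
  using right_idealD(3) by (auto simp: right_quotient_def)

lemma right_quotient_proper:
  "r \<in> carrier R \<Longrightarrow> \<one> \<in> right_quotient R A r \<longleftrightarrow> r \<in> A"
  by (simp add: right_quotient_def)

lemma right_ideal_finsum:
  assumes A: "right_ideal A R" and f: "\<And>j. j \<in> F \<Longrightarrow> f j \<in> A"
  shows "(\<Oplus>j\<in>F. f j) \<in> A"
  using f
proof (induction F rule: infinite_finite_induct)
  case (insert x F)
  then have "f \<in> F \<rightarrow> carrier R" "f x \<in> carrier R" using right_idealD(3)[OF A] by auto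
  then show ?case using insert right_idealD(4)[OF A] by simp
qed (use right_idealD[OF A] in auto)

lemma finsum_swap:
  assumes "finite F" "finite G" "\<And>j k. f j k \<in> carrier R"
  shows "(\<Oplus>j\<in>F. \<Oplus>k\<in>G. f j k) = (\<Oplus>k\<in>G. \<Oplus>j\<in>F. f j k)"
  using assms(1)
proof induction
  case empty
  show ?case by simp
next
  case (insert x F)
  then show ?case using assms(2,3) by (simp add: finsum_addf)
qed

lemma finsum_a_minus:
  assumes "finite F" "\<And>j. f j \<in> carrier R" "\<And>j. g j \<in> carrier R"
  shows "(\<Oplus>j\<in>F. f j \<ominus> g j) = (\<Oplus>j\<in>F. f j) \<ominus> (\<Oplus>j\<in>F. g j)"
  using assms(1)
proof induction
  case empty
  show ?case by (simp add: minus_self)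
next
  case (insert x F)
  then show ?case using assms(2,3)
    by (simp add: finsum_closed Pi_def minus_eq minus_add a_ac)
qed

text \<open>
  Finite linear combinations over different index sets are compared by extending the
  coefficients by zero to a common index set.
\<close>

lemma finsum_pad:
  assumes "finite G" "F \<subseteq> G" "\<And>j. x j \<in> carrier R" "\<And>j. r j \<in> carrier R"
  shows "(\<Oplus>j\<in>G. x j \<otimes> (if j \<in> F then r j else \<zero>)) = (\<Oplus>j\<in>F. x j \<otimes> r j)"
  using assms by (intro add.finprod_mono_neutral_cong_right) auto

text \<open>
  Passing from the cyclic modules \<open>v j R \<cong> R / A\<close> to their submodules \<open>v j t R\<close>.
\<close>

lemma free_modulo_scale:
  fixes v :: "'j \<Rightarrow> 'i \<Rightarrow> 'a"
  assumes fr: "free_modulo R A I S v" and v: "\<And>j i. v j i \<in> carrier R" and t: "t \<in> carrier R"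
  shows "free_modulo R (right_quotient R A t) I S (\<lambda>j i. v j i \<otimes> t)"
  unfolding free_modulo_def
proof (intro allI impI)
  fix F and r :: "'j \<Rightarrow> 'a" assume F: "finite F" "F \<subseteq> S" and r: "\<forall>j. r j \<in> carrier R"
  have "(\<forall>i\<in>I. (\<Oplus>j\<in>F. v j i \<otimes> t \<otimes> r j) = \<zero>) \<longleftrightarrow> (\<forall>i\<in>I. (\<Oplus>j\<in>F. v j i \<otimes> (t \<otimes> r j)) = \<zero>)"
    using v t r by (simp add: m_assoc)
  also have "\<dots> \<longleftrightarrow> (\<forall>j\<in>F. t \<otimes> r j \<in> A)" using t r by (intro free_moduloD[OF fr F]) auto
  finally show "(\<forall>i\<in>I. (\<Oplus>j\<in>F. v j i \<otimes> t \<otimes> r j) = \<zero>) \<longleftrightarrow> (\<forall>j\<in>F. r j \<in> right_quotient R A t)"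
    using r by (simp add: right_quotient_def)
qed

lemma free_modulo_annihilates:
  assumes fr: "free_modulo R A I S v" and A: "right_ideal A R" and v: "\<And>j i. v j i \<in> carrier R"
    and "k \<in> S" "i \<in> I" "s \<in> A"
  shows "v k i \<otimes> s = \<zero>"
proof -
  have s: "s \<in> carrier R" using assms right_idealD(3)[OF A] by blast
  then have "\<forall>i\<in>I. (\<Oplus>j\<in>{k}. v j i \<otimes> s) = \<zero>"
    using free_moduloD[OF fr, of "{k}" "\<lambda>_. s"] assms by simp
  then show ?thesis using assms s by simp
qed

text \<open>
  One step of Gaussian elimination: in the coordinate \<open>i\<close> the vectors \<open>v k r\<close> are combinations of
  the pivots \<open>v j\<close> with \<open>j \<in> F\<close>; subtracting these combinations clears that coordinate. A combination
  of the new vectors with coefficients \<open>s k\<close> is a combination of the old ones with coefficients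
  \<open>r s k\<close> on \<open>G\<close> and \<open>q j\<close> on the pivots. That the \<open>q j\<close> lie in \<open>A\<close> when the \<open>r s k\<close> do follows
  from the freeness of the pivots in the coordinate \<open>i\<close> alone.
\<close>

lemma free_modulo_elimination:
  fixes v :: "'j \<Rightarrow> 'i \<Rightarrow> 'a"
  assumes A: "right_ideal A R" and v: "\<And>j i. v j i \<in> carrier R"
    and fr: "free_modulo R A (insert i I) (F \<union> G) v"
    and F: "finite F" "F \<inter> G = {}" and row: "free_modulo R A {i} F v"
    and r: "r \<in> carrier R" and c: "\<And>k j. c k j \<in> carrier R"
    and dep: "\<And>k. k \<in> G \<Longrightarrow> v k i \<otimes> r = (\<Oplus>j\<in>F. v j i \<otimes> c k j)"
  shows "free_modulo R (right_quotient R A r) I G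
    (\<lambda>k i. v k i \<otimes> r \<ominus> (\<Oplus>j\<in>F. v j i \<otimes> c k j))"
  unfolding free_modulo_def
proof (intro allI impI)
  fix H and s :: "'j \<Rightarrow> 'a" assume H: "finite H" "H \<subseteq> G" and s: "\<forall>j. s j \<in> carrier R"
  then have FH: "F \<inter> H = {}" using F by blast
  define q where "q l = (if l \<in> F then \<ominus> (\<Oplus>k\<in>H. c k l \<otimes> s k) else r \<otimes> s l)" for l
  have q: "q l \<in> carrier R" for l using r c s by (simp add: q_def)
  let ?L = "\<lambda>i. \<Oplus>k\<in>H. (v k i \<otimes> r \<ominus> (\<Oplus>j\<in>F. v j i \<otimes> c k j)) \<otimes> s k"
  have L: "?L i' = (\<Oplus>l\<in>F \<union> H. v l i' \<otimes> q l)" for i'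
  proof -
    have "?L i' = (\<Oplus>k\<in>H. v k i' \<otimes> (r \<otimes> s k) \<ominus> (\<Oplus>j\<in>F. v j i' \<otimes> (c k j \<otimes> s k)))"
      using v r c s F H by (simp add: minus_distr_left finsum_ldistr m_assoc)
    also have "\<dots> = (\<Oplus>k\<in>H. v k i' \<otimes> (r \<otimes> s k)) \<ominus> (\<Oplus>k\<in>H. \<Oplus>j\<in>F. v j i' \<otimes> (c k j \<otimes> s k))"
      using v r c s H by (intro finsum_a_minus) auto
    also have "(\<Oplus>k\<in>H. \<Oplus>j\<in>F. v j i' \<otimes> (c k j \<otimes> s k)) = (\<Oplus>j\<in>F. \<Oplus>k\<in>H. v j i' \<otimes> (c k j \<otimes> s k))"
      using v c s F H by (intro finsum_swap) auto
    also have "\<dots> = (\<Oplus>j\<in>F. v j i' \<otimes> (\<Oplus>k\<in>H. c k j \<otimes> s k))"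
      using v c s H by (simp add: finsum_rdistr)
    also have "(\<Oplus>k\<in>H. v k i' \<otimes> (r \<otimes> s k)) = (\<Oplus>l\<in>H. v l i' \<otimes> q l)"
      using FH v q r s by (intro finsum_cong') (auto simp: q_def)
    also have "(\<Oplus>j\<in>F. v j i' \<otimes> (\<Oplus>k\<in>H. c k j \<otimes> s k)) = (\<Oplus>j\<in>F. \<zero> \<ominus> v j i' \<otimes> q j)"
      using v c s by (intro finsum_cong') (auto simp: q_def r_minus minus_eq)
    also have "\<dots> = \<zero> \<ominus> (\<Oplus>j\<in>F. v j i' \<otimes> q j)"
      using v q F by (simp add: finsum_a_minus)
    also have "(\<Oplus>l\<in>H. v l i' \<otimes> q l) \<ominus> (\<zero> \<ominus> (\<Oplus>j\<in>F. v j i' \<otimes> q j)) =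
        (\<Oplus>j\<in>F. v j i' \<otimes> q j) \<oplus> (\<Oplus>l\<in>H. v l i' \<otimes> q l)"
      using v q by (simp add: minus_eq a_comm)
    also have "\<dots> = (\<Oplus>l\<in>F \<union> H. v l i' \<otimes> q l)"
      using v q F H FH by (simp add: finsum_Un_disjoint)
    finally show ?thesis .
  qed
  have Li: "?L i = \<zero>"
  proof -
    have "(v k i \<otimes> r \<ominus> (\<Oplus>j\<in>F. v j i \<otimes> c k j)) \<otimes> s k = \<zero>" if "k \<in> H" for k
      using dep[of k] that H v c s by (simp add: minus_self subset_iff)
    then show ?thesis by (simp add: add.finprod_one_eqI)
  qed
  have sub: "finite (F \<union> H)" "F \<union> H \<subseteq> F \<union> G" using F H by auto
  have all: "(\<forall>i'\<in>insert i I. ?L i' = \<zero>) \<longleftrightarrow> (\<forall>l\<in>F \<union> H. q l \<in> A)"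
    unfolding L by (rule free_moduloD[OF fr sub q])
  show "(\<forall>i\<in>I. ?L i = \<zero>) \<longleftrightarrow> (\<forall>j\<in>H. s j \<in> right_quotient R A r)"
  proof
    assume "\<forall>i\<in>I. ?L i = \<zero>"
    then have "\<forall>l\<in>F \<union> H. q l \<in> A" using Li all by blast
    moreover have "q k = r \<otimes> s k" if "k \<in> H" for k using that FH by (auto simp: q_def)
    ultimately have "r \<otimes> s k \<in> A" if "k \<in> H" for k using that by (metis UnI2)
    then show "\<forall>j\<in>H. s j \<in> right_quotient R A r"
      using s by (auto simp: right_quotient_def)
  next
    assume sA: "\<forall>j\<in>H. s j \<in> right_quotient R A r"
    have rs: "r \<otimes> s k \<in> A" if "k \<in> H" for k using sA that by (auto simp: right_quotient_def)
    have cs: "c k j \<otimes> s k \<in> A" if "k \<in> H" "j \<in> F" for k j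
    proof -
      have "\<zero> = v k i \<otimes> (r \<otimes> s k)"
        using free_modulo_annihilates[OF fr A v _ _ rs[OF that(1)], of k i] that H by auto
      also have "\<dots> = (\<Oplus>j\<in>F. v j i \<otimes> c k j) \<otimes> s k"
        using dep[of k] that(1) H v r s by (simp add: m_assoc[symmetric] subset_iff)
      also have "\<dots> = (\<Oplus>j\<in>F. v j i \<otimes> (c k j \<otimes> s k))"
        using v c s F by (simp add: finsum_ldistr m_assoc)
      finally have "\<forall>i'\<in>{i}. (\<Oplus>j\<in>F. v j i' \<otimes> (c k j \<otimes> s k)) = \<zero>" by simp
      then have "\<forall>j\<in>F. c k j \<otimes> s k \<in> A"
        using free_moduloD[OF row F(1) subset_refl, of "\<lambda>j. c k j \<otimes> s k"] c s by simp
      then show ?thesis using that by blast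
    qed
    have "q l \<in> A" if "l \<in> F \<union> H" for l
    proof (cases "l \<in> F")
      case True
      then show ?thesis
        using cs right_ideal_finsum[OF A, of H "\<lambda>k. c k l \<otimes> s k"] right_idealD(6)[OF A]
        by (simp add: q_def)
    next
      case False
      then show ?thesis using that rs by (simp add: q_def)
    qed
    then show "\<forall>i\<in>I. ?L i = \<zero>" using all by blast
  qed
qed

text \<open>
  A nontrivial relation that involves \<open>k\<close> must have a coefficient outside \<open>A\<close> at \<open>k\<close>; otherwise
  the term at \<open>k\<close> would vanish and leave a nontrivial relation on \<open>F\<close>.
\<close>

lemma free_modulo_dependence:
  fixes v :: "'j \<Rightarrow> 'i \<Rightarrow> 'a"
  assumes A: "right_ideal A R" and v: "\<And>j i. v j i \<in> carrier R"
    and F: "finite F" and row: "free_modulo R A {i} F v"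
    and nfr: "\<not> free_modulo R A {i} (insert k F) v"
    and ann: "\<And>s. s \<in> A \<Longrightarrow> v k i \<otimes> s = \<zero>"
  obtains s c where "s \<in> carrier R" "s \<notin> A" "\<And>j. c j \<in> carrier R"
    "v k i \<otimes> s = (\<Oplus>j\<in>F. v j i \<otimes> c j)"
proof -
  obtain H and r :: "'j \<Rightarrow> 'a" where H: "finite H" "H \<subseteq> insert k F" and r: "\<And>j. r j \<in> carrier R"
    and bad: "\<not> ((\<forall>i'\<in>{i}. (\<Oplus>j\<in>H. v j i' \<otimes> r j) = \<zero>) \<longleftrightarrow> (\<forall>j\<in>H. r j \<in> A))"
    using nfr unfolding free_modulo_def by blast
  define H' where "H' = H - {k}"
  have H': "finite H'" "H' \<subseteq> F" "k \<notin> H'" using H by (auto simp: H'_def)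
  have iff: "(\<Oplus>j\<in>H'. v j i \<otimes> r j) = \<zero> \<longleftrightarrow> (\<forall>j\<in>H'. r j \<in> A)"
    using free_moduloD[OF row H'(1,2) r] by simp
  have kH: "k \<in> H"
  proof (rule ccontr)
    assume "k \<notin> H"
    then have "H' = H" by (simp add: H'_def)
    then show False using bad iff by blast
  qed
  then have Hk: "H = insert k H'" by (auto simp: H'_def)
  have sum: "(\<Oplus>j\<in>H. v j i \<otimes> r j) = v k i \<otimes> r k \<oplus> (\<Oplus>j\<in>H'. v j i \<otimes> r j)"
    unfolding Hk using H' v r by (simp add: Pi_def)
  have rk: "r k \<notin> A"
  proof
    assume "r k \<in> A"
    then have "(\<Oplus>j\<in>H. v j i \<otimes> r j) = (\<Oplus>j\<in>H'. v j i \<otimes> r j)"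
      using sum ann v r by simp
    then show False using bad iff \<open>r k \<in> A\<close> Hk by simp
  qed
  then have "(\<Oplus>j\<in>H. v j i \<otimes> r j) = \<zero>" using bad kH by auto
  define c where "c j = (if j \<in> H' then \<ominus> r j else \<zero>)" for j
  have "(\<Oplus>j\<in>F. v j i \<otimes> c j) = (\<Oplus>j\<in>H'. v j i \<otimes> \<ominus> r j)"
    unfolding c_def using F H' v r by (intro finsum_pad) auto
  also have "\<dots> = (\<Oplus>j\<in>H'. \<zero> \<ominus> v j i \<otimes> r j)"
    using v r by (simp add: r_minus minus_eq)
  also have "\<dots> = \<zero> \<ominus> (\<Oplus>j\<in>H'. v j i \<otimes> r j)"
    using v r H' by (simp add: finsum_a_minus)
  also have "\<dots> = \<ominus> (\<Oplus>j\<in>H'. v j i \<otimes> r j)" using v r by (simp add: minus_eq)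
  also have "\<dots> = v k i \<otimes> r k"
    using sum \<open>(\<Oplus>j\<in>H. v j i \<otimes> r j) = \<zero>\<close> v r by (intro minus_equality) (auto simp: Pi_def)
  finally have "v k i \<otimes> r k = (\<Oplus>j\<in>F. v j i \<otimes> c j)" by simp
  then show thesis using that[of "r k" c] rk r by (auto simp: c_def)
qed

end

section \<open>Free families of ring elements\<close>

text \<open>
  The coefficients are taken from a right ideal \<open>K\<close>, which covers both the right ideals \<open>x K\<close> with
  a single generator and the spans of infinite families with \<open>K = R\<close>.
\<close>

definition right_span :: "('a, 'm) ring_scheme \<Rightarrow> 'a set \<Rightarrow> ('j \<Rightarrow> 'a) \<Rightarrow> 'a set" where
  "right_span R K x =
     {z. \<exists>F r. finite F \<and> (\<forall>j. r j \<in> K) \<and> z = (\<Oplus>\<^bsub>R\<^esub>j\<in>F. x j \<otimes>\<^bsub>R\<^esub> r j)}"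

context ring
begin

lemma right_span_common:
  fixes x :: "'j \<Rightarrow> 'a"
  assumes K: "right_ideal K R" and x: "\<And>j. x j \<in> carrier R"
    and z: "z \<in> right_span R K x" "z' \<in> right_span R K x"
  shows "\<exists>F r r'. finite F \<and> (\<forall>j. r j \<in> K) \<and> (\<forall>j. r' j \<in> K) \<and>
    z = (\<Oplus>j\<in>F. x j \<otimes> r j) \<and> z' = (\<Oplus>j\<in>F. x j \<otimes> r' j)"
proof -
  obtain F and r :: "'j \<Rightarrow> 'a" where F: "finite F" "\<And>j. r j \<in> K" "z = (\<Oplus>j\<in>F. x j \<otimes> r j)"
    using z(1) unfolding right_span_def by blast
  obtain F' and r' :: "'j \<Rightarrow> 'a" where F': "finite F'" "\<And>j. r' j \<in> K" "z' = (\<Oplus>j\<in>F'. x j \<otimes> r' j)"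
    using z(2) unfolding right_span_def by blast
  let ?r = "\<lambda>j. if j \<in> F then r j else \<zero>" and ?r' = "\<lambda>j. if j \<in> F' then r' j else \<zero>"
  have "z = (\<Oplus>j\<in>F \<union> F'. x j \<otimes> ?r j)" "z' = (\<Oplus>j\<in>F \<union> F'. x j \<otimes> ?r' j)"
    using F F' x right_idealD(3)[OF K] by (simp_all add: finsum_pad)
  moreover have "?r j \<in> K" "?r' j \<in> K" for j using F F' right_idealD(2)[OF K] by auto
  ultimately show ?thesis using F(1) F'(1) by (intro exI[of _ "F \<union> F'"] exI[of _ ?r] exI[of _ ?r']) auto
qed

lemma right_span_memI:
  assumes "finite F" "\<And>j. r j \<in> K"
  shows "(\<Oplus>j\<in>F. x j \<otimes> r j) \<in> right_span R K x"
  using assms unfolding right_span_def by blast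

lemma finsum_combine_add:
  assumes "finite F" "\<And>j. x j \<in> carrier R" "\<And>j. r j \<in> carrier R" "\<And>j. s j \<in> carrier R"
  shows "(\<Oplus>j\<in>F. x j \<otimes> r j) \<oplus> (\<Oplus>j\<in>F. x j \<otimes> s j) = (\<Oplus>j\<in>F. x j \<otimes> (r j \<oplus> s j))"
  using assms by (simp add: r_distr finsum_addf)

lemma finsum_combine_minus:
  assumes "finite F" "\<And>j. x j \<in> carrier R" "\<And>j. r j \<in> carrier R" "\<And>j. s j \<in> carrier R"
  shows "(\<Oplus>j\<in>F. x j \<otimes> r j) \<ominus> (\<Oplus>j\<in>F. x j \<otimes> s j) = (\<Oplus>j\<in>F. x j \<otimes> (r j \<ominus> s j))"
  using assms by (simp add: minus_distr_right finsum_a_minus)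

lemma finsum_combine_mult:
  assumes "finite F" "\<And>j. x j \<in> carrier R" "\<And>j. r j \<in> carrier R" "t \<in> carrier R"
  shows "(\<Oplus>j\<in>F. x j \<otimes> r j) \<otimes> t = (\<Oplus>j\<in>F. x j \<otimes> (r j \<otimes> t))"
  using assms by (simp add: finsum_ldistr m_assoc)

lemma right_ideal_right_span:
  fixes x :: "'j \<Rightarrow> 'a"
  assumes K: "right_ideal K R" and x: "\<And>j. x j \<in> carrier R"
  shows "right_ideal (right_span R K x) R"
proof (rule right_idealI)
  note k = right_idealD[OF K]
  show "right_span R K x \<subseteq> carrier R" using x k by (auto simp: right_span_def)
  have "(\<Oplus>j\<in>{}. x j \<otimes> \<zero>) \<in> right_span R K x" using k by (intro right_span_memI) auto
  then show "\<zero> \<in> right_span R K x" by simp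
next
  note k = right_idealD[OF K]
  fix z z' assume zz: "z \<in> right_span R K x" "z' \<in> right_span R K x"
  obtain F r r' where F: "finite F" "\<And>j. r j \<in> K" "\<And>j. r' j \<in> K"
    "z = (\<Oplus>j\<in>F. x j \<otimes> r j)" "z' = (\<Oplus>j\<in>F. x j \<otimes> r' j)"
    using right_span_common[OF K x zz] by blast
  then have "z \<oplus> z' = (\<Oplus>j\<in>F. x j \<otimes> (r j \<oplus> r' j))"
    using x k by (simp add: finsum_combine_add)
  also have "\<dots> \<in> right_span R K x" using F k by (intro right_span_memI) auto
  finally show "z \<oplus> z' \<in> right_span R K x" .
next
  note k = right_idealD[OF K]
  fix z t assume "z \<in> right_span R K x" and t: "t \<in> carrier R"
  then obtain F and r :: "'j \<Rightarrow> 'a" where F: "finite F" "\<And>j. r j \<in> K" "z = (\<Oplus>j\<in>F. x j \<otimes> r j)"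
    unfolding right_span_def by blast
  then have "z \<otimes> t = (\<Oplus>j\<in>F. x j \<otimes> (r j \<otimes> t))" using x k t by (simp add: finsum_combine_mult)
  also have "\<dots> \<in> right_span R K x" using F k t by (intro right_span_memI) auto
  finally show "z \<otimes> t \<in> right_span R K x" .
qed

text \<open>
  The isomorphism sends a combination of the \<open>x j\<close> to the combination of the \<open>y j\<close> with the same
  coefficients. It is well defined and injective because both families have the same relations,
  namely those with coefficients in \<open>A\<close>.
\<close>

lemma twin_right_spans:
  fixes x y :: "'j \<Rightarrow> 'a"
  assumes A: "right_ideal A R" and K: "right_ideal K R"
    and x: "\<And>j. x j \<in> carrier R" and y: "\<And>j. y j \<in> carrier R"
    and free: "\<And>F r s. finite F \<Longrightarrow> (\<And>j. r j \<in> carrier R) \<Longrightarrow> (\<And>j. s j \<in> carrier R) \<Longrightarrow>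
      (\<Oplus>j\<in>F. x j \<otimes> r j) \<oplus> (\<Oplus>j\<in>F. y j \<otimes> s j) = \<zero> \<longleftrightarrow> (\<forall>j\<in>F. r j \<in> A \<and> s j \<in> A)"
  obtains f where "twin_ideals R (right_span R K x) (right_span R K y) f"
proof -
  note k = right_idealD[OF K]
  have fx: "(\<Oplus>j\<in>F. x j \<otimes> r j) = \<zero> \<longleftrightarrow> (\<forall>j\<in>F. r j \<in> A)"
    if "finite F" "\<And>j. r j \<in> carrier R" for F r
    using free[of F r "\<lambda>_. \<zero>"] that x y right_idealD(2)[OF A] by simp
  have fy: "(\<Oplus>j\<in>F. y j \<otimes> r j) = \<zero> \<longleftrightarrow> (\<forall>j\<in>F. r j \<in> A)"
    if "finite F" "\<And>j. r j \<in> carrier R" for F r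
    using free[of F "\<lambda>_. \<zero>" r] that x y right_idealD(2)[OF A] by simp
  have eq_iff: "(\<Oplus>j\<in>F. w j \<otimes> r j) = (\<Oplus>j\<in>F. w j \<otimes> s j) \<longleftrightarrow> (\<Oplus>j\<in>F. w j \<otimes> (r j \<ominus> s j)) = \<zero>"
    if "finite F" "\<And>j. w j \<in> carrier R" "\<And>j. r j \<in> carrier R" "\<And>j. s j \<in> carrier R"
    for F r s and w :: "'j \<Rightarrow> 'a"
  proof -
    have c: "(\<Oplus>j\<in>F. w j \<otimes> r j) \<in> carrier R" "(\<Oplus>j\<in>F. w j \<otimes> s j) \<in> carrier R" using that by auto
    show ?thesis
      unfolding finsum_combine_minus[OF that, symmetric]
      using minus_eq_zeroD[OF _ c] minus_self[OF c(1)] by auto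
  qed
  have same: "(\<Oplus>j\<in>F. x j \<otimes> r j) = (\<Oplus>j\<in>F. x j \<otimes> s j) \<longleftrightarrow> (\<Oplus>j\<in>F. y j \<otimes> r j) = (\<Oplus>j\<in>F. y j \<otimes> s j)"
    if "finite F" "\<And>j. r j \<in> carrier R" "\<And>j. s j \<in> carrier R" for F r s
    using that x y by (simp add: eq_iff fx fy)
  define f where "f z = (THE u. \<exists>F r. finite F \<and> (\<forall>j. r j \<in> K) \<and>
    z = (\<Oplus>j\<in>F. x j \<otimes> r j) \<and> u = (\<Oplus>j\<in>F. y j \<otimes> r j))" for z
  have f: "f (\<Oplus>j\<in>F. x j \<otimes> r j) = (\<Oplus>j\<in>F. y j \<otimes> r j)" if F: "finite F" and r: "\<And>j. r j \<in> K" for F r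
    unfolding f_def
  proof (rule the_equality)
    show "\<exists>G s. finite G \<and> (\<forall>j. s j \<in> K) \<and> (\<Oplus>j\<in>F. x j \<otimes> r j) = (\<Oplus>j\<in>G. x j \<otimes> s j) \<and>
        (\<Oplus>j\<in>F. y j \<otimes> r j) = (\<Oplus>j\<in>G. y j \<otimes> s j)"
      using F r by blast
  next
    fix u assume "\<exists>G s. finite G \<and> (\<forall>j. s j \<in> K) \<and> (\<Oplus>j\<in>F. x j \<otimes> r j) = (\<Oplus>j\<in>G. x j \<otimes> s j) \<and>
        u = (\<Oplus>j\<in>G. y j \<otimes> s j)"
    then obtain G s where G: "finite G" "\<And>j. s j \<in> K"
      "(\<Oplus>j\<in>F. x j \<otimes> r j) = (\<Oplus>j\<in>G. x j \<otimes> s j)" "u = (\<Oplus>j\<in>G. y j \<otimes> s j)" by blast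
    let ?r = "\<lambda>j. if j \<in> F then r j else \<zero>" and ?s = "\<lambda>j. if j \<in> G then s j else \<zero>"
    have rs: "\<And>j. r j \<in> carrier R" "\<And>j. s j \<in> carrier R" using r G k by auto
    have pad: "(\<Oplus>j\<in>F \<union> G. w j \<otimes> ?r j) = (\<Oplus>j\<in>F. w j \<otimes> r j)"
      "(\<Oplus>j\<in>F \<union> G. w j \<otimes> ?s j) = (\<Oplus>j\<in>G. w j \<otimes> s j)"
      if "\<And>j. w j \<in> carrier R" for w :: "'j \<Rightarrow> 'a"
      using that F G(1) rs by (simp_all add: finsum_pad)
    have "(\<Oplus>j\<in>F \<union> G. x j \<otimes> ?r j) = (\<Oplus>j\<in>F \<union> G. x j \<otimes> ?s j)"
      unfolding pad[OF x] by (rule G(3))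
    then have "(\<Oplus>j\<in>F \<union> G. y j \<otimes> ?r j) = (\<Oplus>j\<in>F \<union> G. y j \<otimes> ?s j)"
      using same[of "F \<union> G" ?r ?s] F G(1) rs by simp
    then show "u = (\<Oplus>j\<in>F. y j \<otimes> r j)" unfolding pad[OF y] G(4) by simp
  qed
  let ?V = "right_span R K x" and ?W = "right_span R K y"
  have V: "right_ideal ?V R" by (rule right_ideal_right_span[OF K x])
  have W: "right_ideal ?W R" by (rule right_ideal_right_span[OF K y])
  have mem: "\<exists>F r. finite F \<and> (\<forall>j. r j \<in> K) \<and> z = (\<Oplus>j\<in>F. x j \<otimes> r j)" if "z \<in> ?V" for z
    using that unfolding right_span_def by blast
  have hom: "f \<in> right_ideal_hom R ?V ?W"
  proof (rule right_ideal_homI)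
    fix z assume "z \<in> ?V"
    with mem obtain F r where F: "finite F" "\<And>j. r j \<in> K" "z = (\<Oplus>j\<in>F. x j \<otimes> r j)" by meson
    show "f z \<in> ?W" unfolding F(3) f[OF F(1,2)] using F by (intro right_span_memI) auto
  next
    fix z z' assume zz: "z \<in> ?V" "z' \<in> ?V"
    obtain F r r' where F: "finite F" "\<And>j. r j \<in> K" "\<And>j. r' j \<in> K"
      "z = (\<Oplus>j\<in>F. x j \<otimes> r j)" "z' = (\<Oplus>j\<in>F. x j \<otimes> r' j)"
      using right_span_common[OF K x zz] by blast
    have rc: "\<And>j. r j \<in> carrier R" "\<And>j. r' j \<in> carrier R" using F k by auto
    have "f (z \<oplus> z') = (\<Oplus>j\<in>F. y j \<otimes> (r j \<oplus> r' j))"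
      unfolding F(4,5) finsum_combine_add[OF F(1) x rc] using F k by (intro f) auto
    also have "\<dots> = f z \<oplus> f z'"
      unfolding F(4,5) f[OF F(1,2)] f[OF F(1,3)] finsum_combine_add[OF F(1) y rc] ..
    finally show "f (z \<oplus> z') = f z \<oplus> f z'" .
  next
    fix z t assume "z \<in> ?V" and t: "t \<in> carrier R"
    with mem obtain F r where F: "finite F" "\<And>j. r j \<in> K" "z = (\<Oplus>j\<in>F. x j \<otimes> r j)" by meson
    have rc: "\<And>j. r j \<in> carrier R" using F k by auto
    have "f (z \<otimes> t) = (\<Oplus>j\<in>F. y j \<otimes> (r j \<otimes> t))"
      unfolding F(3) finsum_combine_mult[OF F(1) x rc t] using F k t by (intro f) auto
    also have "\<dots> = f z \<otimes> t"
      unfolding F(3) f[OF F(1,2)] finsum_combine_mult[OF F(1) y rc t] ..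
    finally show "f (z \<otimes> t) = f z \<otimes> t" .
  qed
  have "inj_on f ?V"
  proof (rule inj_onI)
    fix z z' assume zz: "z \<in> ?V" "z' \<in> ?V" and eq: "f z = f z'"
    obtain F r r' where F: "finite F" "\<And>j. r j \<in> K" "\<And>j. r' j \<in> K"
      "z = (\<Oplus>j\<in>F. x j \<otimes> r j)" "z' = (\<Oplus>j\<in>F. x j \<otimes> r' j)"
      using right_span_common[OF K x zz] by blast
    show "z = z'"
      using eq unfolding F(4,5) f[OF F(1,2)] f[OF F(1,3)]
      using same[of F r r'] F k by simp
  qed
  moreover have "f ` ?V = ?W"
  proof
    show "f ` ?V \<subseteq> ?W" using right_ideal_homD(1)[OF hom] by blast
    show "?W \<subseteq> f ` ?V"
    proof
      fix u assume "u \<in> ?W"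
      then obtain F and r :: "'j \<Rightarrow> 'a" where F: "finite F" "\<And>j. r j \<in> K" "u = (\<Oplus>j\<in>F. y j \<otimes> r j)"
        unfolding right_span_def by blast
      have "u = f (\<Oplus>j\<in>F. x j \<otimes> r j)" using F(3) f[OF F(1,2)] by simp
      then show "u \<in> f ` ?V" using right_span_memI[OF F(1,2), of x] by (rule image_eqI)
    qed
  qed
  moreover have "?V \<inter> ?W = {\<zero>}"
  proof (intro equalityI subsetI)
    fix z assume z: "z \<in> ?V \<inter> ?W"
    then obtain F r where F: "finite F" "\<And>j. r j \<in> K" "z = (\<Oplus>j\<in>F. x j \<otimes> r j)"
      using mem by (meson IntD1)
    from z obtain G and s :: "'j \<Rightarrow> 'a" where G: "finite G" "\<And>j. s j \<in> K" "z = (\<Oplus>j\<in>G. y j \<otimes> s j)"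
      unfolding right_span_def by blast
    let ?r = "\<lambda>j. if j \<in> F then r j else \<zero>" and ?s = "\<lambda>j. if j \<in> G then s j else \<zero>"
    have rc: "\<And>j. r j \<in> carrier R" "\<And>j. s j \<in> carrier R" using F G k by auto
    have zx: "z = (\<Oplus>j\<in>F \<union> G. x j \<otimes> ?r j)" using F G(1) x rc by (simp add: finsum_pad)
    have zy: "z = (\<Oplus>j\<in>F \<union> G. y j \<otimes> ?s j)" using F(1) G y rc by (simp add: finsum_pad)
    have zc: "z \<in> carrier R" using F x rc by simp
    have "\<zero> \<ominus> z = (\<Oplus>j\<in>F \<union> G. y j \<otimes> \<zero>) \<ominus> (\<Oplus>j\<in>F \<union> G. y j \<otimes> ?s j)" using y zy by simp
    also have "\<dots> = (\<Oplus>j\<in>F \<union> G. y j \<otimes> (\<zero> \<ominus> ?s j))"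
      using y rc F(1) G(1) by (intro finsum_combine_minus) auto
    finally have "(\<Oplus>j\<in>F \<union> G. y j \<otimes> (\<zero> \<ominus> ?s j)) = \<zero> \<ominus> z" ..
    moreover have "z \<oplus> (\<zero> \<ominus> z) = \<zero>" using zc by (simp add: minus_eq r_neg)
    ultimately have "z \<oplus> (\<Oplus>j\<in>F \<union> G. y j \<otimes> (\<zero> \<ominus> ?s j)) = \<zero>" by (simp only:)
    then have "(\<Oplus>j\<in>F \<union> G. x j \<otimes> ?r j) \<oplus> (\<Oplus>j\<in>F \<union> G. y j \<otimes> (\<zero> \<ominus> ?s j)) = \<zero>"
      unfolding zx[symmetric] .
    then have "\<forall>j\<in>F \<union> G. ?r j \<in> A"
      using free[of "F \<union> G" ?r "\<lambda>j. \<zero> \<ominus> ?s j"] F(1) G(1) rc by simp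
    then have "z = \<zero>" unfolding zx using fx[of "F \<union> G" ?r] F(1) G(1) rc by simp
    then show "z \<in> {\<zero>}" by simp
  next
    fix z assume "z \<in> {\<zero>}"
    then show "z \<in> ?V \<inter> ?W"
      using right_idealD(2)[OF V] right_idealD(2)[OF W] by simp
  qed
  ultimately have "twin_ideals R ?V ?W f"
    unfolding twin_ideals_def bij_betw_def
    using hom V W by blast
  then show thesis using that by blast
qed

lemma maximal_right_ideal_exists:
  assumes A: "right_ideal A R" and "\<one> \<notin> A"
  obtains M where "maximal_right_ideal R M" "A \<subseteq> M"
proof -
  obtain M where M: "right_ideal M R" "A \<subseteq> M" "M \<inter> {\<one>} = {}"
    and max: "\<And>Q. right_ideal Q R \<Longrightarrow> M \<subseteq> Q \<Longrightarrow> Q \<inter> {\<one>} = {} \<Longrightarrow> Q = M"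
    using right_ideal_avoiding_maximal[OF A, of "{\<one>}"] assms(2) by blast
  note m = right_idealD[OF M(1)]
  have "\<exists>t\<in>carrier R. s \<otimes> t \<ominus> \<one> \<in> M" if s: "s \<in> carrier R" "s \<notin> M" for s
  proof -
    note sum = right_ideal_sum[OF M(1) right_ideal_cyclic[OF s(1)]]
    have "s \<in> (\<lambda>r. s \<otimes> r) ` carrier R" using s by (intro image_eqI[of _ _ \<one>]) auto
    then have "\<one> \<in> M <+>\<^bsub>R\<^esub> (\<lambda>r. s \<otimes> r) ` carrier R"
      using max[OF sum(1,2)] sum(3) s(2) by blast
    then obtain a t where at: "a \<in> M" "t \<in> carrier R" "\<one> = a \<oplus> s \<otimes> t"
      by (auto simp: set_add_def')
    then have ac: "a \<in> carrier R" using m by blast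
    have "s \<otimes> t \<ominus> \<one> = s \<otimes> t \<ominus> (a \<oplus> s \<otimes> t)" using at(3) by simp
    also have "\<dots> = \<ominus> a" using at s ac by (simp add: minus_eq minus_add a_lcomm r_neg)
    finally show ?thesis using at(1,2) m(6)[of a] by metis
  qed
  then have "maximal_right_ideal R M" using M by (auto simp: maximal_right_ideal_def)
  then show thesis using that M by blast
qed

end

context a_ring
begin

text \<open>
  Let \<open>M\<close> be a maximal right ideal that contains \<open>A\<close>. The right ideals \<open>x M\<close> and \<open>y M\<close> are
  independent and isomorphic, so some \<open>g \<in> x M\<close> acts as the identity on \<open>x M\<close>. Writing
  \<open>g x = x m1\<close> with \<open>m1 \<in> M\<close>, the element \<open>x - g x = x t\<close> with \<open>t = \<one> - m1\<close> generates a complement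
  of \<open>x M\<close> in \<open>x R\<close>, and this complement is isomorphic to the simple module \<open>R / M\<close>.
\<close>

lemma free_pair_maximal_quotient:
  assumes A: "right_ideal A R" "\<one> \<notin> A" and x: "x \<in> carrier R" and y: "y \<in> carrier R"
    and free: "\<And>r s. r \<in> carrier R \<Longrightarrow> s \<in> carrier R \<Longrightarrow>
      x \<otimes> r \<oplus> y \<otimes> s = \<zero> \<longleftrightarrow> r \<in> A \<and> s \<in> A"
  obtains t where "t \<in> carrier R" "t \<notin> A" "maximal_right_ideal R (right_quotient R A t)"
proof -
  obtain M where M: "maximal_right_ideal R M" and AM: "A \<subseteq> M"
    using maximal_right_ideal_exists[OF A] by blast
  then have MR: "right_ideal M R" and M1: "\<one> \<notin> M" by (auto simp: maximal_right_ideal_def)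
  note m = right_idealD[OF MR] and a = right_idealD[OF A(1)]
  have units: "F = {} \<or> F = {()}" for F :: "unit set" by auto
  obtain f where "twin_ideals R (right_span R M (\<lambda>_::unit. x)) (right_span R M (\<lambda>_::unit. y)) f"
  proof (rule twin_right_spans[OF A(1) MR, of "\<lambda>_::unit. x" "\<lambda>_. y"])
    fix F :: "unit set" and r s :: "unit \<Rightarrow> 'a"
    assume "\<And>j. r j \<in> carrier R" "\<And>j. s j \<in> carrier R"
    then show "(\<Oplus>j\<in>F. x \<otimes> r j) \<oplus> (\<Oplus>j\<in>F. y \<otimes> s j) = \<zero> \<longleftrightarrow> (\<forall>j\<in>F. r j \<in> A \<and> s j \<in> A)"
      using units[of F] x y free[of "r ()" "s ()"] by auto
  qed (use x y in auto)
  then obtain g where g: "g \<in> right_span R M (\<lambda>_::unit. x)"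
    and gv: "\<And>v. v \<in> right_span R M (\<lambda>_::unit. x) \<Longrightarrow> g \<otimes> v = v"
    using twin_generator by blast
  have span: "right_ideal (right_span R M (\<lambda>_::unit. x)) R"
    by (rule right_ideal_right_span[OF MR x])
  have gc: "g \<in> carrier R" using g right_idealD(3)[OF span] by blast
  have xM: "x \<otimes> s \<in> right_span R M (\<lambda>_::unit. x)" if "s \<in> M" for s
    using right_span_memI[of "{()}" "\<lambda>_. s" M "\<lambda>_. x"] that x m by simp
  have "g \<otimes> x \<in> right_span R M (\<lambda>_::unit. x)" using g x right_idealD(5)[OF span] by blast
  then obtain F :: "unit set" and r where "\<And>j. r j \<in> M" "g \<otimes> x = (\<Oplus>j\<in>F. x \<otimes> r j)"
    unfolding right_span_def by blast
  then have "g \<otimes> x = x \<otimes> r () \<or> g \<otimes> x = x \<otimes> \<zero>" using units[of F] x m by auto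
  then obtain m1 where m1: "m1 \<in> M" "g \<otimes> x = x \<otimes> m1" using \<open>\<And>j. r j \<in> M\<close> m by blast
  define t where "t = \<one> \<ominus> m1"
  have t: "t \<in> carrier R" using m1 m by (simp add: t_def)
  have xt: "x \<otimes> t = x \<ominus> g \<otimes> x" using m1 m x by (simp add: t_def minus_distr_right)
  have tA: "t \<notin> A"
  proof
    assume "t \<in> A"
    then have "t \<oplus> m1 \<in> M" using AM m1 m by blast
    then show False using M1 m1 m by (simp add: t_def add_minus_cancel)
  qed
  let ?Q = "right_quotient R A t"
  have Q: "right_ideal ?Q R" by (rule right_ideal_right_quotient[OF A(1) t])
  have MQ: "M \<subseteq> ?Q"
  proof
    fix s assume s: "s \<in> M"
    then have sc: "s \<in> carrier R" using m by blast
    have "x \<otimes> (t \<otimes> s) = x \<otimes> s \<ominus> g \<otimes> (x \<otimes> s)"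
      using xt x t sc gc by (simp add: m_assoc[symmetric] minus_distr_left)
    also have "\<dots> = \<zero>" using gv[OF xM[OF s]] x sc by (simp add: minus_self)
    finally have "x \<otimes> (t \<otimes> s) \<oplus> y \<otimes> \<zero> = \<zero>" using y by simp
    then have "t \<otimes> s \<in> A" using free[of "t \<otimes> s" \<zero>] t sc by simp
    then show "s \<in> ?Q" using sc by (simp add: right_quotient_def)
  qed
  have "?Q \<subseteq> M"
  proof (rule ccontr)
    assume "\<not> ?Q \<subseteq> M"
    then obtain s where s: "s \<in> ?Q" "s \<notin> M" by blast
    then have sc: "s \<in> carrier R" by (simp add: right_quotient_def)
    then obtain u where u: "u \<in> carrier R" "s \<otimes> u \<ominus> \<one> \<in> M"
      using M s unfolding maximal_right_ideal_def by blast
    have "s \<otimes> u \<ominus> (s \<otimes> u \<ominus> \<one>) \<in> ?Q"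
      using right_idealD(7)[OF Q right_idealD(5)[OF Q s(1) u(1)] subsetD[OF MQ u(2)]] .
    also have "s \<otimes> u \<ominus> (s \<otimes> u \<ominus> \<one>) = \<one>"
      using sc u(1) by (simp add: minus_eq minus_add a_assoc[symmetric] r_neg)
    finally show False using right_quotient_proper[OF t] tA by simp
  qed
  then have "?Q = M" using MQ by blast
  then show thesis using that[OF t tA] M by simp
qed

text \<open>
  Split a sequence from the family into two disjoint subsequences \<open>x\<close> and \<open>y\<close>. Their spans are
  independent and isomorphic, so an element \<open>g\<close> of the span of \<open>x\<close> acts on that span as the identity.
  But \<open>g\<close> involves only finitely many \<open>x j\<close>, and so \<open>x n = g x n\<close> would be a relation for every
  other \<open>n\<close>.
\<close>

lemma no_infinite_free_row:
  fixes v :: "'j \<Rightarrow> 'i \<Rightarrow> 'a"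
  assumes A: "right_ideal A R" "\<one> \<notin> A" and v: "\<And>j i. v j i \<in> carrier R"
    and S: "infinite S" and fr: "free_modulo R A {i} S v"
  shows False
proof -
  note a = right_idealD[OF A(1)]
  obtain e0 :: "nat \<Rightarrow> 'j" where e0: "inj e0" "range e0 \<subseteq> S"
    using infinite_countable_subset[OF S] by blast
  define e where "e = e0 \<circ> sum_encode"
  have e: "inj e" unfolding e_def by (rule inj_compose[OF e0(1) inj_sum_encode])
  have eS: "e p \<in> S" for p using e0(2) by (auto simp: e_def)
  define x y where "x = (\<lambda>n. v (e (Inl n)) i)" and "y = (\<lambda>n. v (e (Inr n)) i)"
  have xc: "x n \<in> carrier R" and yc: "y n \<in> carrier R" for n using v by (auto simp: x_def y_def)
  have free: "(\<Oplus>j\<in>F. x j \<otimes> r j) \<oplus> (\<Oplus>j\<in>F. y j \<otimes> s j) = \<zero> \<longleftrightarrow> (\<forall>j\<in>F. r j \<in> A \<and> s j \<in> A)"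
    if F: "finite F" and r: "\<And>j. r j \<in> carrier R" and s: "\<And>j. s j \<in> carrier R" for F r s
  proof -
    define \<rho> where "\<rho> l = (case inv_into UNIV e l of Inl n \<Rightarrow> r n | Inr n \<Rightarrow> s n)" for l
    have \<rho>: "\<rho> l \<in> carrier R" for l using r s by (simp add: \<rho>_def split: sum.split)
    have \<rho>e: "\<rho> (e (Inl n)) = r n" "\<rho> (e (Inr n)) = s n" for n using e by (auto simp: \<rho>_def)
    let ?X = "(\<lambda>n. e (Inl n)) ` F" and ?Y = "(\<lambda>n. e (Inr n)) ` F"
    have inj: "inj_on (\<lambda>n. e (Inl n)) F" "inj_on (\<lambda>n. e (Inr n)) F"
      using injD[OF e] by (auto intro!: inj_onI)
    have disj: "?X \<inter> ?Y = {}" using injD[OF e] by auto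
    have "(\<Oplus>l\<in>?X. v l i \<otimes> \<rho> l) = (\<Oplus>j\<in>F. x j \<otimes> r j)"
      using inj v \<rho> by (subst finsum_reindex) (auto simp: \<rho>e x_def)
    moreover have "(\<Oplus>l\<in>?Y. v l i \<otimes> \<rho> l) = (\<Oplus>j\<in>F. y j \<otimes> s j)"
      using inj v \<rho> by (subst finsum_reindex) (auto simp: \<rho>e y_def)
    moreover have "(\<Oplus>l\<in>?X \<union> ?Y. v l i \<otimes> \<rho> l) = (\<Oplus>l\<in>?X. v l i \<otimes> \<rho> l) \<oplus> (\<Oplus>l\<in>?Y. v l i \<otimes> \<rho> l)"
      using F disj v \<rho> by (intro finsum_Un_disjoint) auto
    moreover have "(\<Oplus>l\<in>?X \<union> ?Y. v l i \<otimes> \<rho> l) = \<zero> \<longleftrightarrow> (\<forall>l\<in>?X \<union> ?Y. \<rho> l \<in> A)"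
      using free_moduloD[OF fr, of "?X \<union> ?Y" \<rho>] F eS \<rho> by auto
    moreover have "(\<forall>l\<in>?X \<union> ?Y. \<rho> l \<in> A) \<longleftrightarrow> (\<forall>j\<in>F. r j \<in> A \<and> s j \<in> A)"
      by (simp add: ball_Un \<rho>e) blast
    ultimately show ?thesis by simp
  qed
  obtain f where "twin_ideals R (right_span R (carrier R) x) (right_span R (carrier R) y) f"
    using twin_right_spans[OF A(1) right_ideal_carrier xc yc free] by blast
  then obtain g where g: "g \<in> right_span R (carrier R) x"
    and gv: "\<And>z. z \<in> right_span R (carrier R) x \<Longrightarrow> g \<otimes> z = z"
    using twin_generator by blast
  obtain F and r :: "nat \<Rightarrow> 'a" where F: "finite F" and r: "\<And>j. r j \<in> carrier R"
    and gF: "g = (\<Oplus>j\<in>F. x j \<otimes> r j)"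
    using g unfolding right_span_def by blast
  obtain n where n: "n \<notin> F" using F ex_new_if_finite infinite_UNIV_nat by blast
  have "x n \<in> right_span R (carrier R) x"
    using right_span_memI[of "{n}" "\<lambda>_. \<one>" "carrier R" x] xc by simp
  then have "x n = (\<Oplus>j\<in>F. x j \<otimes> r j) \<otimes> x n" using gv gF by simp
  also have "\<dots> = (\<Oplus>j\<in>F. x j \<otimes> (r j \<otimes> x n))" using F r xc by (simp add: finsum_combine_mult)
  finally have xn: "(\<Oplus>j\<in>F. x j \<otimes> (r j \<otimes> x n)) = x n" ..
  \<comment> \<open>The coefficients of the relation \<open>g x n - x n = 0\<close>; the one at \<open>n\<close> is the unit \<open>- \<one>\<close>.\<close>
  define \<rho> where "\<rho> j = (if j = n then \<ominus> \<one> else r j \<otimes> x n)" for j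
  have \<rho>: "\<rho> j \<in> carrier R" for j using r xc by (simp add: \<rho>_def)
  have "(\<Oplus>j\<in>F. x j \<otimes> \<rho> j) = (\<Oplus>j\<in>F. x j \<otimes> (r j \<otimes> x n))"
    using n xc r by (intro finsum_cong') (auto simp: \<rho>_def)
  then have "(\<Oplus>j\<in>insert n F. x j \<otimes> \<rho> j) = \<ominus> x n \<oplus> x n"
    using F n xc \<rho> xn by (simp add: Pi_def) (simp add: \<rho>_def r_minus)
  then have "(\<Oplus>j\<in>insert n F. x j \<otimes> \<rho> j) \<oplus> (\<Oplus>j\<in>insert n F. y j \<otimes> \<zero>) = \<zero>"
    using xc yc by (simp add: l_neg)
  then have "\<rho> n \<in> A" using free[of "insert n F" \<rho> "\<lambda>_. \<zero>"] F \<rho> by simp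
  then have "\<ominus> (\<ominus> \<one>) \<in> A" using a(6)[of "\<ominus> \<one>"] by (simp add: \<rho>_def)
  then show False using A(2) by simp
qed

end

section \<open>Bounding the size of free families of vectors\<close>

context a_ring
begin

text \<open>
  Induction on the number of coordinates. In the coordinate \<open>i\<close> a maximal free subfamily \<open>T\<close>
  exists by Zorn's lemma, since freeness is a condition on finite subfamilies, and \<open>T\<close> is finite
  because \<open>R\<close> contains no infinite free family. As \<open>R / B\<close> is simple, every other entry is a
  combination of those in \<open>T\<close>, and elimination leaves the infinite family indexed by \<open>S - T\<close>.
\<close>

lemma no_infinite_free_family:
  fixes v :: "'j \<Rightarrow> 'i \<Rightarrow> 'a"
  assumes "finite I" and B: "maximal_right_ideal R B" and "\<And>j i. v j i \<in> carrier R"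
    and "infinite S" and "free_modulo R B I S v"
  shows False
  using assms(1,3-)
proof (induction I arbitrary: v S rule: finite_induct)
  case empty
  then obtain k where "k \<in> S" by fastforce
  then have "\<one> \<in> B" using free_moduloD[OF empty(3), of "{k}" "\<lambda>_. \<one>"] by simp
  then show False using B by (simp add: maximal_right_ideal_def)
next
  case (insert i I)
  have BR: "right_ideal B R" and B1: "\<one> \<notin> B" using B by (auto simp: maximal_right_ideal_def)
  note b = right_idealD[OF BR] and v = insert.prems(1) and fr = insert.prems(3)
  let ?\<T> = "{T. T \<subseteq> S \<and> free_modulo R B {i} T v}"
  have "\<exists>T\<in>?\<T>. \<forall>X\<in>?\<T>. T \<subseteq> X \<longrightarrow> X = T"
  proof (rule subset_Zorn_nonempty)
    have "{} \<in> ?\<T>" by (simp add: free_modulo_def)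
    then show "?\<T> \<noteq> {}" by blast
  next
    fix C assume C: "C \<noteq> {}" "subset.chain ?\<T> C"
    then have sub: "C \<subseteq> ?\<T>" by (simp add: subset_chain_def)
    have "free_modulo R B {i} (\<Union>C) v"
      unfolding free_modulo_def
    proof (intro allI impI)
      fix F and r :: "'j \<Rightarrow> 'a" assume F: "finite F" "F \<subseteq> \<Union>C" and r: "\<forall>j. r j \<in> carrier R"
      obtain T where "T \<in> C" "F \<subseteq> T" using finite_subset_Union_chain[OF F C] by blast
      moreover from this have "free_modulo R B {i} T v" using sub by blast
      ultimately show "(\<forall>i\<in>{i}. (\<Oplus>j\<in>F. v j i \<otimes> r j) = \<zero>) \<longleftrightarrow> (\<forall>j\<in>F. r j \<in> B)"
        using F r by (intro free_moduloD) auto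
    qed
    then show "\<Union>C \<in> ?\<T>" using sub by blast
  qed
  then obtain T where T: "T \<subseteq> S" "free_modulo R B {i} T v"
    and max: "\<forall>X\<in>?\<T>. T \<subseteq> X \<longrightarrow> X = T" by auto
  have fT: "finite T"
  proof (rule ccontr)
    assume "infinite T"
    from no_infinite_free_row[OF BR B1 v this T(2)] show False .
  qed
  have "\<exists>c. (\<forall>j. c j \<in> carrier R) \<and> (k \<in> S - T \<longrightarrow> v k i \<otimes> \<one> = (\<Oplus>j\<in>T. v j i \<otimes> c j))" for k
  proof (cases "k \<in> S - T")
    case True
    then have nfr: "\<not> free_modulo R B {i} (insert k T) v" using max T(1) by blast
    have ann: "v k i \<otimes> s = \<zero>" if "s \<in> B" for s
      using free_modulo_annihilates[OF fr BR v, of k i s] True that by simp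
    obtain s c where s: "s \<in> carrier R" "s \<notin> B" and c: "\<And>j. c j \<in> carrier R"
      and eq: "v k i \<otimes> s = (\<Oplus>j\<in>T. v j i \<otimes> c j)"
      using free_modulo_dependence[OF BR v fT T(2) nfr ann] by blast
    \<comment> \<open>Modulo \<open>B\<close>, which annihilates the entry \<open>v k i\<close>, the coefficient \<open>s\<close> has the right inverse \<open>t\<close>.\<close>
    obtain t where t: "t \<in> carrier R" "s \<otimes> t \<ominus> \<one> \<in> B"
      using B s unfolding maximal_right_ideal_def by blast
    have st: "s \<otimes> t = (s \<otimes> t \<ominus> \<one>) \<oplus> \<one>" using s t by (simp add: add_minus_cancel)
    have "v k i \<otimes> \<one> = v k i \<otimes> (s \<otimes> t)"
      using ann[OF t(2)] v[of k i] s t by (subst st) (simp add: r_distr)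
    also have "\<dots> = (\<Oplus>j\<in>T. v j i \<otimes> c j) \<otimes> t"
      using eq v s t by (simp add: m_assoc[symmetric])
    also have "\<dots> = (\<Oplus>j\<in>T. v j i \<otimes> (c j \<otimes> t))"
      using fT v c t by (intro finsum_combine_mult) auto
    finally show ?thesis using c t by (intro exI[of _ "\<lambda>j. c j \<otimes> t"]) auto
  next
    case False
    then show ?thesis by (intro exI[of _ "\<lambda>_. \<zero>"]) auto
  qed
  then obtain c where c: "\<And>k j. c k j \<in> carrier R"
    and dep: "\<And>k. k \<in> S - T \<Longrightarrow> v k i \<otimes> \<one> = (\<Oplus>j\<in>T. v j i \<otimes> c k j)" by metis
  have "T \<union> (S - T) = S" using T(1) by blast
  then have fr': "free_modulo R B (insert i I) (T \<union> (S - T)) v" using fr by simp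
  have "free_modulo R (right_quotient R B \<one>) I (S - T)
      (\<lambda>k i. v k i \<otimes> \<one> \<ominus> (\<Oplus>j\<in>T. v j i \<otimes> c k j))"
    by (rule free_modulo_elimination[OF BR v fr' fT _ T(2) one_closed c dep]) auto
  then have fr1: "free_modulo R B I (S - T) (\<lambda>k i. v k i \<otimes> \<one> \<ominus> (\<Oplus>j\<in>T. v j i \<otimes> c k j))"
    by (simp only: right_quotient_one[OF BR])
  have inf: "infinite (S - T)" using fT insert.prems(2) by simp
  show False by (rule insert.IH[OF _ inf fr1]) (use v c in auto)
qed

text \<open>
  Induction on the number of coordinates. Among the nonzero submodules \<open>(r R + A) / A\<close> of \<open>R / A\<close>
  and the index sets \<open>F\<close> for which the entries \<open>v j i r\<close> with \<open>j \<in> F\<close> are free, take a pair with \<open>F\<close>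
  as large as possible. A free pair would yield a simple submodule of \<open>R / A\<close>, so \<open>F\<close> has at most
  one element. By the choice of \<open>F\<close>, each of the other entries becomes a combination of the entries
  in \<open>F\<close> on every sufficiently small nonzero submodule, and one submodule serves all of the finitely many
  entries at once. Eliminating the coordinate \<open>i\<close> loses only the index set \<open>F\<close>.
\<close>

lemma free_family_card_le:
  fixes v :: "'j \<Rightarrow> 'i \<Rightarrow> 'a"
  assumes "finite I" and "right_ideal A R" "\<one> \<notin> A"
    and "\<And>t. t \<in> carrier R \<Longrightarrow> \<not> maximal_right_ideal R (right_quotient R A t)"
    and "\<And>j i. v j i \<in> carrier R" and "finite S" and "free_modulo R A I S v"
  shows "card S \<le> card I"
  using assms
proof (induction I arbitrary: A v S rule: finite_induct)
  case empty
  have "S = {}"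
  proof (rule ccontr)
    assume "S \<noteq> {}"
    then obtain k where "k \<in> S" by blast
    then have "\<one> \<in> A" using free_moduloD[OF empty(6), of "{k}" "\<lambda>_. \<one>"] by simp
    then show False using empty by simp
  qed
  then show ?case by simp
next
  case (insert i I)
  note A = insert.prems(1,2) and nomax = insert.prems(3) and v = insert.prems(4)
    and S = insert.prems(5) and fr = insert.prems(6)
  let ?P = "\<lambda>p. fst p \<in> carrier R - A \<and> snd p \<subseteq> S \<and>
    free_modulo R (right_quotient R A (fst p)) {i} (snd p) (\<lambda>j i. v j i \<otimes> fst p)"
  have "?P (\<one>, {})" using A(2) by (simp add: free_modulo_def)
  moreover have "\<forall>p. ?P p \<longrightarrow> card (snd p) < Suc (card S)"
    using S by (auto intro: card_mono simp: less_Suc_eq_le)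
  ultimately obtain p where p: "?P p" and pmax: "\<And>q. ?P q \<Longrightarrow> card (snd q) \<le> card (snd p)"
    using ex_has_greatest_nat[of ?P _ "\<lambda>p. card (snd p)"] by blast
  obtain r F where pr: "p = (r, F)" by (cases p)
  \<comment> \<open>From here on \<open>A\<close> and \<open>v\<close> are replaced by \<open>A1\<close> and \<open>w\<close>, the data of the submodules generated by \<open>r\<close>.\<close>
  define A1 where "A1 = right_quotient R A r"
  define w where "w = (\<lambda>j i. v j i \<otimes> r)"
  have r: "r \<in> carrier R" "r \<notin> A" and FS: "F \<subseteq> S" and row: "free_modulo R A1 {i} F w"
    using p by (auto simp: pr A1_def w_def)
  have fF: "finite F" using FS S by (rule finite_subset)
  have A1: "right_ideal A1 R" unfolding A1_def by (rule right_ideal_right_quotient[OF A(1) r(1)])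
  have A1p: "\<one> \<notin> A1" using r right_quotient_proper by (simp add: A1_def)
  have w: "w j i \<in> carrier R" for j i using v r by (simp add: w_def)
  have frw: "free_modulo R A1 (insert i I) S w"
    unfolding A1_def w_def by (rule free_modulo_scale[OF fr v r(1)])
  have A1t: "right_quotient R A1 t = right_quotient R A (r \<otimes> t)" if "t \<in> carrier R" for t
    unfolding A1_def by (rule right_quotient_right_quotient[OF r(1) that])
  have cF: "card F \<le> 1"
  proof (rule ccontr)
    assume "\<not> card F \<le> 1"
    then obtain j k where jk: "j \<in> F" "k \<in> F" "j \<noteq> k"
      using fF by (metis One_nat_def card_le_Suc0_iff_eq)
    have "w j i \<otimes> a \<oplus> w k i \<otimes> b = \<zero> \<longleftrightarrow> a \<in> A1 \<and> b \<in> A1"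
      if "a \<in> carrier R" "b \<in> carrier R" for a b
      using free_moduloD[OF row, of "{j, k}" "\<lambda>l. if l = j then a else b"] jk that w by auto
    then obtain t where "t \<in> carrier R" "maximal_right_ideal R (right_quotient R A1 t)"
      using free_pair_maximal_quotient[OF A1 A1p w w, of j i k i] by metis
    then show False using nomax[of "r \<otimes> t"] A1t r by simp
  qed
  have dep1: "\<exists>s\<in>carrier R. t \<otimes> s \<notin> A1 \<and>
      (\<exists>c. (\<forall>j. c j \<in> carrier R) \<and> w k i \<otimes> (t \<otimes> s) = (\<Oplus>j\<in>F. w j i \<otimes> c j))"
    if k: "k \<in> S - F" and t: "t \<in> carrier R" "t \<notin> A1" for k t
  proof -
    let ?A = "right_quotient R A1 t" and ?w = "\<lambda>j i. w j i \<otimes> t"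
    have A2: "right_ideal ?A R" by (rule right_ideal_right_quotient[OF A1 t(1)])
    have w2: "\<And>j i. w j i \<otimes> t \<in> carrier R" using w t by simp
    have row2: "free_modulo R ?A {i} F ?w" by (rule free_modulo_scale[OF row w t(1)])
    have fr2: "free_modulo R ?A (insert i I) S ?w" by (rule free_modulo_scale[OF frw w t(1)])
    have nfr: "\<not> free_modulo R ?A {i} (insert k F) ?w"
    proof
      assume "free_modulo R ?A {i} (insert k F) ?w"
      moreover have "?w = (\<lambda>j i. v j i \<otimes> (r \<otimes> t))"
        using v r t by (auto simp: w_def m_assoc fun_eq_iff)
      moreover have "r \<otimes> t \<in> carrier R - A" using r t by (auto simp: A1_def right_quotient_def)
      ultimately have "?P (r \<otimes> t, insert k F)" using FS k A1t[OF t(1)] by auto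
      from pmax[OF this] show False using k fF by (simp add: pr)
    qed
    have ann: "w k i \<otimes> t \<otimes> s = \<zero>" if "s \<in> ?A" for s
      using free_modulo_annihilates[OF fr2 A2 w2, of k i s] k that by simp
    obtain s c where s: "s \<in> carrier R" "s \<notin> ?A" and c: "\<And>j. c j \<in> carrier R"
      and eq: "w k i \<otimes> t \<otimes> s = (\<Oplus>j\<in>F. w j i \<otimes> t \<otimes> c j)"
      using free_modulo_dependence[OF A2 w2 fF row2 nfr ann] by blast
    have "w k i \<otimes> (t \<otimes> s) = (\<Oplus>j\<in>F. w j i \<otimes> (t \<otimes> c j))"
      using eq w t s c by (simp add: m_assoc)
    moreover have "t \<otimes> s \<notin> A1" using s by (simp add: right_quotient_def)
    ultimately show ?thesis
      using s c t by (intro bexI[of _ s] conjI exI[of _ "\<lambda>j. t \<otimes> c j"]) auto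
  qed
  have "\<exists>t\<in>carrier R - A1. \<forall>k\<in>G.
      \<exists>c. (\<forall>j. c j \<in> carrier R) \<and> w k i \<otimes> t = (\<Oplus>j\<in>F. w j i \<otimes> c j)"
    if "finite G" "G \<subseteq> S - F" for G
    using that
  proof (induction G rule: finite_induct)
    case empty
    show ?case using A1p by (intro bexI[of _ \<one>]) auto
  next
    case (insert k G)
    have "G \<subseteq> S - F" using insert.prems by simp
    from insert.IH[OF this] obtain t where "t \<in> carrier R - A1"
      and G: "\<forall>l\<in>G. \<exists>c. (\<forall>j. c j \<in> carrier R) \<and> w l i \<otimes> t = (\<Oplus>j\<in>F. w j i \<otimes> c j)"
      by (rule bexE)
    then have t: "t \<in> carrier R" "t \<notin> A1" by auto
    have "k \<in> S - F" using insert.prems by simp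
    note dep1[OF this t]
    then obtain s where s: "s \<in> carrier R" "t \<otimes> s \<notin> A1"
      and k: "\<exists>c. (\<forall>j. c j \<in> carrier R) \<and> w k i \<otimes> (t \<otimes> s) = (\<Oplus>j\<in>F. w j i \<otimes> c j)"
      by blast
    have "\<exists>c. (\<forall>j. c j \<in> carrier R) \<and> w l i \<otimes> (t \<otimes> s) = (\<Oplus>j\<in>F. w j i \<otimes> c j)" if l: "l \<in> G" for l
    proof -
      obtain c where c: "\<And>j. c j \<in> carrier R" "w l i \<otimes> t = (\<Oplus>j\<in>F. w j i \<otimes> c j)"
        using bspec[OF G l] by blast
      have "w l i \<otimes> (t \<otimes> s) = (\<Oplus>j\<in>F. w j i \<otimes> c j) \<otimes> s"
        using c(2) w t s by (simp add: m_assoc[symmetric])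
      also have "\<dots> = (\<Oplus>j\<in>F. w j i \<otimes> (c j \<otimes> s))"
        using fF w c(1) s by (intro finsum_combine_mult) auto
      finally show ?thesis using c s by (intro exI[of _ "\<lambda>j. c j \<otimes> s"]) auto
    qed
    then show ?case using k s t by (intro bexI[of _ "t \<otimes> s"]) auto
  qed
  from this[OF finite_Diff[OF S] subset_refl]
  obtain t where t: "t \<in> carrier R" "t \<notin> A1"
    and "\<forall>k\<in>S - F. \<exists>c. (\<forall>j. c j \<in> carrier R) \<and> w k i \<otimes> t = (\<Oplus>j\<in>F. w j i \<otimes> c j)" by blast
  then have "\<exists>c. (\<forall>j. c j \<in> carrier R) \<and> (k \<in> S - F \<longrightarrow> w k i \<otimes> t = (\<Oplus>j\<in>F. w j i \<otimes> c j))" for k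
    by (cases "k \<in> S - F") (auto intro!: exI[of _ "\<lambda>_. \<zero>"])
  then obtain c where c: "\<And>k j. c k j \<in> carrier R"
    and dep: "\<And>k. k \<in> S - F \<Longrightarrow> w k i \<otimes> t = (\<Oplus>j\<in>F. w j i \<otimes> c k j)" by metis
  have "F \<union> (S - F) = S" using FS by blast
  then have fr': "free_modulo R A1 (insert i I) (F \<union> (S - F)) w" using frw by simp
  have fr1: "free_modulo R (right_quotient R A1 t) I (S - F)
      (\<lambda>k i. w k i \<otimes> t \<ominus> (\<Oplus>j\<in>F. w j i \<otimes> c k j))"
    by (rule free_modulo_elimination[OF A1 w fr' fF _ row t(1) c dep]) auto
  have "card (S - F) \<le> card I"
  proof (rule insert.IH[OF right_ideal_right_quotient[OF A1 t(1)] _ _ _ _ fr1])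
    show "\<one> \<notin> right_quotient R A1 t" using t right_quotient_proper by simp
    fix u assume "u \<in> carrier R"
    then show "\<not> maximal_right_ideal R (right_quotient R (right_quotient R A1 t) u)"
      using nomax[of "r \<otimes> (t \<otimes> u)"] r t by (simp add: A1t right_quotient_right_quotient m_assoc)
  qed (use w t c S in auto)
  moreover have "card S = card F + card (S - F)"
    using FS S by (simp add: card_Diff_subset card_mono fF)
  ultimately show ?case using cF insert.hyps by simp
qed

text \<open>
  If some \<open>right_quotient R A t\<close> is maximal, then \<open>R / A\<close> has a simple submodule, and the family
  can be restricted to copies of it. Otherwise already \<open>card I + 1\<close> members of the sequence are too
  many.
\<close>

lemma no_free_sequence:
  fixes v :: "nat \<Rightarrow> 'i \<Rightarrow> 'a"
  assumes I: "finite I" and A: "right_ideal A R" "\<one> \<notin> A" and v: "\<And>j i. v j i \<in> carrier R"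
    and fr: "free_modulo R A I UNIV v"
  shows False
proof (cases "\<exists>t\<in>carrier R. maximal_right_ideal R (right_quotient R A t)")
  case True
  then obtain t where t: "t \<in> carrier R" "maximal_right_ideal R (right_quotient R A t)" by blast
  show False
    by (rule no_infinite_free_family[OF I t(2) _ infinite_UNIV_nat free_modulo_scale[OF fr v t(1)]])
      (use v t in auto)
next
  case False
  have "card {..card I} \<le> card I"
    by (rule free_family_card_le[OF I A _ v _ free_modulo_subset[OF fr]]) (use False in auto)
  then show False by simp
qed

end

section \<open>Matrices acting on columns\<close>

context ring
begin

text \<open>
  Vectors are total functions; the value outside the index range is zero so that all entries lie
  in the carrier.
\<close>

definition matrix_action :: "nat \<Rightarrow> (nat \<times> nat \<Rightarrow> 'a) \<Rightarrow> (nat \<Rightarrow> 'a) \<Rightarrow> nat \<Rightarrow> 'a" where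
  "matrix_action n X w i = (if i < n then \<Oplus>k\<in>{..<n}. X (i, k) \<otimes> w k else \<zero>)"

lemma matrix_entry_closed:
  assumes "X \<in> carrier (matrix_ring R n)" "i < n" "k < n"
  shows "X (i, k) \<in> carrier R"
  using assms by (auto simp: matrix_ring_def PiE_iff)

lemma matrix_action_closed:
  assumes "X \<in> carrier (matrix_ring R n)" "\<And>k. w k \<in> carrier R"
  shows "matrix_action n X w i \<in> carrier R"
  using assms by (auto simp: matrix_action_def matrix_entry_closed)

lemma matrix_action_mult:
  assumes X: "X \<in> carrier (matrix_ring R n)" and Y: "Y \<in> carrier (matrix_ring R n)"
    and w: "\<And>k. w k \<in> carrier R"
  shows "matrix_action n (X \<otimes>\<^bsub>matrix_ring R n\<^esub> Y) w = matrix_action n X (matrix_action n Y w)"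
proof
  fix i
  show "matrix_action n (X \<otimes>\<^bsub>matrix_ring R n\<^esub> Y) w i = matrix_action n X (matrix_action n Y w) i"
  proof (cases "i < n")
    case True
    note cl = matrix_entry_closed[OF X] matrix_entry_closed[OF Y]
    define x where "x k = (if k < n then X (i, k) else \<zero>)" for k
    define y where "y k l = (if k < n \<and> l < n then Y (k, l) else \<zero>)" for k l
    have xy: "x k \<in> carrier R" "y k l \<in> carrier R" for k l
      using True by (auto simp: x_def y_def cl)
    have "matrix_action n (X \<otimes>\<^bsub>matrix_ring R n\<^esub> Y) w i =
        (\<Oplus>l\<in>{..<n}. (\<Oplus>k\<in>{..<n}. X (i, k) \<otimes> Y (k, l)) \<otimes> w l)"
      using True cl w unfolding matrix_action_def
      by (auto simp: matrix_ring_def intro!: finsum_cong')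
    also have "\<dots> = (\<Oplus>l\<in>{..<n}. (\<Oplus>k\<in>{..<n}. x k \<otimes> y k l) \<otimes> w l)"
      using True cl w by (intro finsum_cong' arg_cong2[of _ _ _ _ "(\<otimes>)"] refl)
        (auto simp: x_def y_def)
    also have "\<dots> = (\<Oplus>l\<in>{..<n}. \<Oplus>k\<in>{..<n}. x k \<otimes> (y k l \<otimes> w l))"
      using xy w by (simp add: finsum_ldistr m_assoc)
    also have "\<dots> = (\<Oplus>k\<in>{..<n}. \<Oplus>l\<in>{..<n}. x k \<otimes> (y k l \<otimes> w l))"
      using xy w by (intro finsum_swap) auto
    also have "\<dots> = (\<Oplus>k\<in>{..<n}. x k \<otimes> (\<Oplus>l\<in>{..<n}. y k l \<otimes> w l))"
      using xy w by (simp add: finsum_rdistr)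
    also have "\<dots> = (\<Oplus>k\<in>{..<n}. X (i, k) \<otimes> (\<Oplus>l\<in>{..<n}. Y (k, l) \<otimes> w l))"
      using True cl w by (intro finsum_cong' arg_cong2[of _ _ _ _ "(\<otimes>)"] refl)
        (auto simp: x_def y_def)
    also have "\<dots> = matrix_action n X (matrix_action n Y w) i"
      using True cl w by (auto simp: matrix_action_def intro!: finsum_cong')
    finally show ?thesis .
  qed (simp add: matrix_action_def)
qed

lemma matrix_action_one:
  assumes w: "\<And>k. w k \<in> carrier R" and "i < n"
  shows "matrix_action n \<one>\<^bsub>matrix_ring R n\<^esub> w i = w i"
proof -
  have "matrix_action n \<one>\<^bsub>matrix_ring R n\<^esub> w i = (\<Oplus>k\<in>{..<n}. if i = k then w k else \<zero>)"
    using assms unfolding matrix_action_def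
    by (auto simp: matrix_ring_def intro!: finsum_cong')
  also have "\<dots> = w i" using assms by (intro finsum_singleton) auto
  finally show ?thesis .
qed

text \<open>
  Right linearity of the action, stated for the linear combinations that occur in the definition
  of freeness.
\<close>

lemma matrix_action_finsum:
  assumes X: "X \<in> carrier (matrix_ring R n)" and F: "finite F"
    and w: "\<And>j k. w j k \<in> carrier R" and r: "\<And>j. r j \<in> carrier R" and i: "i < n"
  shows "(\<Oplus>j\<in>F. matrix_action n X (w j) i \<otimes> r j) = matrix_action n X (\<lambda>k. \<Oplus>j\<in>F. w j k \<otimes> r j) i"
proof -
  note cl = matrix_entry_closed[OF X i]
  define x where "x k = (if k < n then X (i, k) else \<zero>)" for k
  have x: "x k \<in> carrier R" for k by (auto simp: x_def cl)
  have act: "matrix_action n X u i = (\<Oplus>k\<in>{..<n}. x k \<otimes> u k)" if "\<And>k. u k \<in> carrier R" for u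
    using i cl that by (auto simp: matrix_action_def x_def intro!: finsum_cong')
  have "(\<Oplus>j\<in>F. matrix_action n X (w j) i \<otimes> r j) = (\<Oplus>j\<in>F. \<Oplus>k\<in>{..<n}. x k \<otimes> (w j k \<otimes> r j))"
    using x w r by (simp add: act finsum_ldistr m_assoc)
  also have "\<dots> = (\<Oplus>k\<in>{..<n}. \<Oplus>j\<in>F. x k \<otimes> (w j k \<otimes> r j))"
    using x w r F by (intro finsum_swap) auto
  also have "\<dots> = (\<Oplus>k\<in>{..<n}. x k \<otimes> (\<Oplus>j\<in>F. w j k \<otimes> r j))"
    using x w r F by (simp add: finsum_rdistr)
  also have "\<dots> = matrix_action n X (\<lambda>k. \<Oplus>j\<in>F. w j k \<otimes> r j) i"
    using w r by (subst act) auto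
  finally show ?thesis .
qed

lemma matrix_action_unit_vector:
  assumes X: "X \<in> carrier (matrix_ring R n)" and "i < n" "c < n"
  shows "matrix_action n X (\<lambda>k. if c = k then \<one> else \<zero>) i = X (i, c)"
proof -
  note cl = matrix_entry_closed[OF X \<open>i < n\<close>]
  have "matrix_action n X (\<lambda>k. if c = k then \<one> else \<zero>) i =
      (\<Oplus>k\<in>{..<n}. if c = k then X (i, k) else \<zero>)"
    using assms cl unfolding matrix_action_def by (auto intro!: finsum_cong')
  also have "\<dots> = X (i, c)" using assms cl by (intro finsum_singleton) auto
  finally show ?thesis .
qed

lemma matrix_mult_closed:
  assumes X: "X \<in> carrier (matrix_ring R n)" and Y: "Y \<in> carrier (matrix_ring R n)"
  shows "X \<otimes>\<^bsub>matrix_ring R n\<^esub> Y \<in> carrier (matrix_ring R n)"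
  using matrix_entry_closed[OF X] matrix_entry_closed[OF Y]
  by (auto simp: matrix_ring_def intro!: finsum_closed)

lemma matrix_one_closed: "\<one>\<^bsub>matrix_ring R n\<^esub> \<in> carrier (matrix_ring R n)"
  by (auto simp: matrix_ring_def)

lemma matrix_eqI:
  assumes X: "X \<in> carrier (matrix_ring R n)" and Y: "Y \<in> carrier (matrix_ring R n)"
    and "\<And>i c. i < n \<Longrightarrow> c < n \<Longrightarrow> X (i, c) = Y (i, c)"
  shows "X = Y"
proof (rule PiE_ext)
  show "X \<in> {..<n} \<times> {..<n} \<rightarrow>\<^sub>E carrier R" "Y \<in> {..<n} \<times> {..<n} \<rightarrow>\<^sub>E carrier R"
    using X Y by (simp_all add: matrix_ring_def)
qed (use assms(3) in auto)

end

context a_ring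
begin

text \<open>
  If \<open>Y X \<noteq> \<one>\<close>, then \<open>z = e\<^sub>c - Y (X e\<^sub>c)\<close> is nonzero for some unit vector \<open>e\<^sub>c\<close>, and
  \<open>X z = 0\<close>. The sequence \<open>Y\<^sup>j z\<close> is free modulo the annihilator of \<open>z\<close>: applying \<open>X\<close> to a relation
  deletes its first term and shifts the others, so induction on the length puts all coefficients but
  the first into the annihilator, and the relation itself then gives the first.
\<close>

lemma matrix_ring_directly_finite: "directly_finite (matrix_ring R n)"
  unfolding directly_finite_def
proof (intro ballI impI)
  let ?M = "matrix_ring R n"
  fix X Y assume X: "X \<in> carrier ?M" and Y: "Y \<in> carrier ?M" and XY: "X \<otimes>\<^bsub>?M\<^esub> Y = \<one>\<^bsub>?M\<^esub>"
  let ?X = "matrix_action n X" and ?Y = "matrix_action n Y"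
  let ?e = "\<lambda>c k. if c = k then \<one> else \<zero>"
  have XYw: "?X (?Y w) i = w i" if "\<And>k. w k \<in> carrier R" "i < n" for w i
    using matrix_action_mult[OF X Y that(1)] matrix_action_one[OF that] XY by simp
  have YX: "?Y (?X (?e c)) i = ?e c i" if "i < n" "c < n" for i c
  proof (rule ccontr)
    assume ne: "?Y (?X (?e c)) i \<noteq> ?e c i"
    have ec: "\<And>k. ?e c k \<in> carrier R" by simp
    define z where "z k = ?e c k \<ominus> ?Y (?X (?e c)) k" for k
    have z: "z k \<in> carrier R" for k
      unfolding z_def using matrix_action_closed[OF Y matrix_action_closed[OF X ec]] ec by simp
    have Xz: "?X z k = \<zero>" if k: "k < n" for k
    proof -
      \<comment> \<open>\<open>z\<close> is the combination of \<open>e\<^sub>c\<close> and \<open>Y (X e\<^sub>c)\<close> with coefficients \<open>\<one>\<close> and \<open>- \<one>\<close>, indexed by the booleans.\<close>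
      define w where "w j = (if j then ?e c else ?Y (?X (?e c)))" for j
      define r where "r j = (if j then \<one> else \<ominus> \<one>)" for j
      have w: "w j l \<in> carrier R" for j l
        using matrix_action_closed[OF Y matrix_action_closed[OF X ec]] ec by (simp add: w_def)
      have r: "r j \<in> carrier R" for j by (simp add: r_def)
      have zw: "z = (\<lambda>l. \<Oplus>j\<in>UNIV. w j l \<otimes> r j)"
      proof
        fix l
        show "z l = (\<Oplus>j\<in>UNIV. w j l \<otimes> r j)"
          using w[of True l] w[of False l]
          by (simp add: z_def UNIV_bool r_def r_minus minus_eq a_comm) (simp add: w_def)
      qed
      have "?X z k = (\<Oplus>j\<in>UNIV. ?X (w j) k \<otimes> r j)"
        unfolding zw by (rule matrix_action_finsum[OF X _ w r k, symmetric]) simp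
      also have "\<dots> = ?X (w True) k \<ominus> ?X (w False) k"
        using matrix_action_closed[OF X w] by (simp add: UNIV_bool r_def r_minus minus_eq a_comm)
      also have "\<dots> = ?X (?e c) k \<ominus> ?X (?Y (?X (?e c))) k" by (simp add: w_def)
      also have "?X (?Y (?X (?e c))) k = ?X (?e c) k"
        by (rule XYw[OF matrix_action_closed[OF X ec] k])
      also have "?X (?e c) k \<ominus> ?X (?e c) k = \<zero>"
        by (rule minus_self[OF matrix_action_closed[OF X ec]])
      finally show ?thesis .
    qed
    define v where "v j = (?Y ^^ j) z" for j
    have v: "v j k \<in> carrier R" for j k
    proof (induction j arbitrary: k)
      case (Suc j)
      then show ?case by (simp add: v_def matrix_action_closed[OF Y])
    qed (simp add: v_def z)
    have Xv: "?X (v (Suc j)) k = v j k" if "k < n" for j k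
      using XYw[of "v j" k, OF v that] by (simp add: v_def)
    define A where "A = {s \<in> carrier R. \<forall>k<n. z k \<otimes> s = \<zero>}"
    have A: "right_ideal A R"
      using z by (intro right_idealI) (auto simp: A_def r_distr m_assoc[symmetric])
    have A1: "\<one> \<notin> A"
    proof
      assume "\<one> \<in> A"
      then have "z i = \<zero>" using that z by (simp add: A_def)
      then have "?e c i \<ominus> ?Y (?X (?e c)) i = \<zero>" by (simp only: z_def)
      from minus_eq_zeroD[OF this ec matrix_action_closed[OF Y matrix_action_closed[OF X ec]]]
      show False using ne by simp
    qed
    have ann: "v j k \<otimes> s = \<zero>" if s: "s \<in> A" and "k < n" for j k s
      using \<open>k < n\<close>
    proof (induction j arbitrary: k)
      case 0
      then show ?case using s by (simp add: v_def A_def)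
    next
      case (Suc j)
      have sc: "s \<in> carrier R" using s by (simp add: A_def)
      have "v (Suc j) k \<otimes> s = (\<Oplus>l\<in>{()}. ?Y (v j) k \<otimes> s)"
        using v[of "Suc j" k] sc by (simp add: v_def)
      also have "\<dots> = ?Y (\<lambda>l. \<Oplus>u\<in>{()}. v j l \<otimes> s) k"
        by (rule matrix_action_finsum[OF Y _ v sc Suc.prems]) simp
      also have "\<dots> = (\<Oplus>l\<in>{..<n}. Y (k, l) \<otimes> \<zero>)"
        using Suc v sc matrix_entry_closed[OF Y]
        by (auto simp: matrix_action_def intro!: finsum_cong')
      also have "\<dots> = \<zero>"
        using Suc.prems matrix_entry_closed[OF Y] by (intro add.finprod_one_eqI) auto
      finally show ?case .
    qed
    have seg: "\<forall>j<m. r j \<in> A"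
      if "\<And>j. r j \<in> carrier R" "\<And>k. k < n \<Longrightarrow> (\<Oplus>j\<in>{..<m}. v j k \<otimes> r j) = \<zero>" for m and r :: "nat \<Rightarrow> 'a"
      using that
    proof (induction m arbitrary: r)
      case (Suc m)
      note r = Suc.prems(1)
      have split: "(\<Oplus>j\<in>{..<Suc m}. f j) = f 0 \<oplus> (\<Oplus>j\<in>{..<m}. f (Suc j))"
        if "\<And>j. f j \<in> carrier R" for f
      proof -
        have "{..<Suc m} = insert 0 (Suc ` {..<m})" by (auto simp: lessThan_Suc_eq_insert_0)
        then show ?thesis using that by (simp add: Pi_def finsum_reindex)
      qed
      have "(\<Oplus>j\<in>{..<m}. v j k \<otimes> r (Suc j)) = \<zero>" if k: "k < n" for k
      proof -
        have "\<zero> = ?X (\<lambda>k. \<Oplus>j\<in>{..<Suc m}. v j k \<otimes> r j) k"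
          using k Suc.prems(2) matrix_entry_closed[OF X k] unfolding matrix_action_def
          by (auto intro!: add.finprod_one_eqI[symmetric])
        also have "\<dots> = (\<Oplus>j\<in>{..<Suc m}. ?X (v j) k \<otimes> r j)"
          by (rule matrix_action_finsum[OF X _ v r k, symmetric]) simp
        also have "\<dots> = ?X (v 0) k \<otimes> r 0 \<oplus> (\<Oplus>j\<in>{..<m}. ?X (v (Suc j)) k \<otimes> r (Suc j))"
          using matrix_action_closed[OF X v] r by (intro split) auto
        also have "\<dots> = (\<Oplus>j\<in>{..<m}. v j k \<otimes> r (Suc j))"
          using Xz[OF k] Xv[OF k] v r by (simp add: v_def[of 0])
        finally show ?thesis ..
      qed
      then have tail: "\<forall>j<m. r (Suc j) \<in> A" using r by (intro Suc.IH) auto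
      have "z k \<otimes> r 0 = \<zero>" if k: "k < n" for k
      proof -
        have "\<zero> = v 0 k \<otimes> r 0 \<oplus> (\<Oplus>j\<in>{..<m}. v (Suc j) k \<otimes> r (Suc j))"
          using Suc.prems(2)[OF k] split[of "\<lambda>j. v j k \<otimes> r j"] v r by simp
        also have "(\<Oplus>j\<in>{..<m}. v (Suc j) k \<otimes> r (Suc j)) = \<zero>"
          using tail ann k by (intro add.finprod_one_eqI) auto
        finally show ?thesis using z[of k] r by (simp add: v_def)
      qed
      then have "r 0 \<in> A" using r by (simp add: A_def)
      then show ?case using tail by (auto simp: less_Suc_eq_0_disj)
    qed simp
    have "free_modulo R A {..<n} UNIV v"
      unfolding free_modulo_def
    proof (intro allI impI iffI)
      fix F and r :: "nat \<Rightarrow> 'a" assume F: "finite F" and r: "\<forall>j. r j \<in> carrier R"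
        and 0: "\<forall>k\<in>{..<n}. (\<Oplus>j\<in>F. v j k \<otimes> r j) = \<zero>"
      obtain m where m: "F \<subseteq> {..<m}" using F unfolding finite_nat_set_iff_bounded by blast
      have "\<forall>j<m. (if j \<in> F then r j else \<zero>) \<in> A"
        using 0 r m v by (intro seg) (auto simp: finsum_pad)
      then show "\<forall>j\<in>F. r j \<in> A" using m by (metis lessThan_iff subsetD)
    next
      fix F and r :: "nat \<Rightarrow> 'a" assume "\<forall>j\<in>F. r j \<in> A"
      then show "\<forall>k\<in>{..<n}. (\<Oplus>j\<in>F. v j k \<otimes> r j) = \<zero>"
        using ann by (auto intro!: add.finprod_one_eqI)
    qed
    then show False by (rule no_free_sequence[OF _ A A1 v, rotated]) simp
  qed
  show "Y \<otimes>\<^bsub>?M\<^esub> X = \<one>\<^bsub>?M\<^esub>"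
  proof (rule matrix_eqI[OF matrix_mult_closed[OF Y X] matrix_one_closed])
    fix i c assume ic: "i < n" "c < n"
    have ec: "\<And>k. ?e c k \<in> carrier R" by simp
    have "(Y \<otimes>\<^bsub>?M\<^esub> X) (i, c) = ?Y (?X (?e c)) i"
      using matrix_action_unit_vector[OF matrix_mult_closed[OF Y X] ic]
        matrix_action_mult[OF Y X ec] by simp
    also have "\<dots> = \<one>\<^bsub>?M\<^esub> (i, c)" using YX[OF ic] ic by (auto simp: matrix_ring_def)
    finally show "(Y \<otimes>\<^bsub>?M\<^esub> X) (i, c) = \<one>\<^bsub>?M\<^esub> (i, c)" .
  qed
qed

end

theorem theorem4p3:
  fixes R :: "('a, 'm) ring_scheme"
  assumes "right_a_ring TYPE('e) R"
  shows "stably_finite R"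
proof -
  interpret a_ring R by (rule a_ring_right_a_ring[OF assms])
  show ?thesis using matrix_ring_directly_finite by (simp add: stably_finite_def)
qed

end
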